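(* Let $r\ge1$ be an integer. Fix $\omega\in\mathbb{R}$ and let $S:\mathbb{R}^{r+1}\to\mathbb{R}$ be a local potential satisfying conditions A, B and C, with Peierls barrier $P_\omega$. For every $\varepsilon>0$ there are $\delta>0$ and $K>0$ such that, whenever $S^\delta:\mathbb{R}^{r+1}\to\mathbb{R}$ satisfies conditions A, B and C and the estimates $\|S^\delta-S\|_{C^0(\mathbb{X}_K)}<\delta$ and $\|S^\delta-S\|_{C^1(\mathbb{X}_K)}\le1$, then $$\sup_{\xi\in\mathbb{R}}|P^\delta_\omega(\xi)-P_\omega(\xi)|<\varepsilon,$$ where $P^\delta_\omega$ denotes the Peierls barrier of $S^\delta$.
   Context: Conditions on $S:\mathbb{R}^{r+1}\to\mathbb{R}$, written as $S(x_0,\dots,x_r)$: A (periodicity): $S(x_0+1,\dots,x_r+1)=S(x_0,\dots,x_r)$ for all arguments. B (monotonicity): $S$ is $C^2$, $\partial_i\partial_k S\le 0$ everywhere for all $i\ne k$, and $\partial_0\partial_1 S<0$ everywhere. C (coercivity): $S$ is bounded from below and there is $k\in\{0,\dots,r-1\}$ such that $S(x_0,\dots,x_r)\to\infty$ as $|x_{k+1}-x_k|\to\infty$. For $p,q\in\mathbb{Z}$ with $p\ge1$ let $\mathbb{X}_{p,q}$ be the set of sequences $x:\mathbb{Z}\to\mathbb{R}$ with $x_{i-p}+q=x_i$ for all $i$, and for $x\in\mathbb{X}_{p,q}$ let $W_{p,q}(x)=\sum_{j=0}^{p-1}S(x_j,\dots,x_{j+r})$. For a rational $q/p$ in lowest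 terms (with $p\ge1$) and $\xi\in\mathbb{R}$, the Peierls barrier of $S$ is $$P_{q/p}(\xi)=\min_{x\in\mathbb{X}_{p,q},\,x_0=\xi}W_{p,q}(x)-\min_{x\in\mathbb{X}_{p,q}}W_{p,q}(x).$$ For irrational $\omega$, $P_\omega(\xi)=\lim_{q/p\to\omega}P_{q/p}(\xi)$, the limit being over rationals converging to $\omega$ (this limit exists). For $K>0$, $\mathbb{X}_K=\{x:\mathbb{Z}\to\mathbb{R} : |x_{i+1}-x_i|\le K\text{ for all }i\in\mathbb{Z}\}$. $\|f\|_{C^0(\mathbb{X}_K)}$ is the supremum of $|f(x_0,\dots,x_r)|$ over $x\in\mathbb{X}_K$, and $\|f\|_{C^1(\mathbb{X}_K)}$ is the maximum of the suprema over $x\in\mathbb{X}_K$ of $|f(x_0,\dots,x_r)|$ and $|\partial_k f(x_0,\dots,x_r)|$, $0\le k\le r$. *)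

theory Defs
  imports "HOL-Analysis.Analysis"
begin

text \<open>
  The space of arguments \<open>(x\<^sub>0, \<dots>, x\<^sub>r)\<close> is \<open>real ^ 'n\<close> where \<open>'n\<close> is a finite linearly ordered
  type with \<open>r + 1\<close> elements; an index \<open>i :: 'n\<close> stands for the number \<open>pos i\<close> in \<open>{0, \<dots>, r}\<close>.
\<close>

definition pos :: "'n::{finite,linorder} \<Rightarrow> nat" where
  "pos i = card {..<i}"

definition partial :: "'n::finite \<Rightarrow> (real ^ 'n \<Rightarrow> real) \<Rightarrow> real ^ 'n \<Rightarrow> real" where
  "partial k f x = deriv (\<lambda>t. f (x + t *\<^sub>R axis k 1)) 0"

definition is_C1 :: "(real ^ 'n::finite \<Rightarrow> real) \<Rightarrow> bool" where
  "is_C1 f \<longleftrightarrow> (\<forall>x. f differentiable (at x)) \<and> (\<forall>k. continuous_on UNIV (partial k f))"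

definition is_C2 :: "(real ^ 'n::finite \<Rightarrow> real) \<Rightarrow> bool" where
  "is_C2 f \<longleftrightarrow> is_C1 f \<and> (\<forall>k. is_C1 (partial k f))"

definition condA :: "(real ^ 'n::finite \<Rightarrow> real) \<Rightarrow> bool" where
  "condA S \<longleftrightarrow> (\<forall>x. S (\<chi> i. x $ i + 1) = S x)"

definition condB :: "(real ^ 'n::{finite,linorder} \<Rightarrow> real) \<Rightarrow> bool" where
  "condB S \<longleftrightarrow> is_C2 S \<and>
     (\<forall>i k x. i \<noteq> k \<longrightarrow> partial i (partial k S) x \<le> 0) \<and>
     (\<forall>i k x. pos i = 0 \<and> pos k = 1 \<longrightarrow> partial i (partial k S) x < 0)"

definition condC :: "(real ^ 'n::{finite,linorder} \<Rightarrow> real) \<Rightarrow> bool" where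
  "condC S \<longleftrightarrow> bdd_below (range S) \<and>
     (\<exists>k l. pos l = pos k + 1 \<and>
        filterlim S at_top (filtercomap (\<lambda>x. \<bar>x $ l - x $ k\<bar>) at_top))"

definition window :: "(int \<Rightarrow> real) \<Rightarrow> int \<Rightarrow> real ^ 'n::{finite,linorder}" where
  "window x j = (\<chi> i. x (j + int (pos i)))"

definition per_seqs :: "int \<Rightarrow> int \<Rightarrow> (int \<Rightarrow> real) set" where
  "per_seqs p q = {x. \<forall>i. x (i - p) + of_int q = x i}"

definition per_action :: "(real ^ 'n::{finite,linorder} \<Rightarrow> real) \<Rightarrow> int \<Rightarrow> (int \<Rightarrow> real) \<Rightarrow> real" where
  "per_action S p x = (\<Sum>j\<in>{0..<p}. S (window x j))"

text \<open>
  The filter describes rationals converging to \<open>\<omega>\<close>; for irrational \<open>\<omega>\<close> they are never equal to \<open>\<omega>\<close>.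
\<close>

definition peierls_rat :: "(real ^ 'n::{finite,linorder} \<Rightarrow> real) \<Rightarrow> rat \<Rightarrow> real \<Rightarrow> real" where
  "peierls_rat S a \<xi> =
     (let (q, p) = quotient_of a in
       (LEAST w. w \<in> per_action S p ` {x \<in> per_seqs p q. x 0 = \<xi>}) -
       (LEAST w. w \<in> per_action S p ` per_seqs p q))"

definition peierls :: "(real ^ 'n::{finite,linorder} \<Rightarrow> real) \<Rightarrow> real \<Rightarrow> real \<Rightarrow> real" where
  "peierls S \<omega> \<xi> =
     (if \<omega> \<in> \<rat> then peierls_rat S (THE a. real_of_rat a = \<omega>) \<xi>
      else Lim (filtercomap real_of_rat (nhds \<omega>)) (\<lambda>a. peierls_rat S a \<xi>))"

definition lip_seqs :: "real \<Rightarrow> (int \<Rightarrow> real) set" where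
  "lip_seqs K = {x. \<forall>i. \<bar>x (i + 1) - x i\<bar> \<le> K}"

text \<open>The norms take values in the extended reals, so that unbounded suprema are infinite.\<close>

definition C0_norm :: "real \<Rightarrow> (real ^ 'n::{finite,linorder} \<Rightarrow> real) \<Rightarrow> ereal" where
  "C0_norm K f = (SUP x\<in>lip_seqs K. ereal \<bar>f (window x 0)\<bar>)"

definition C1_norm :: "real \<Rightarrow> (real ^ 'n::{finite,linorder} \<Rightarrow> real) \<Rightarrow> ereal" where
  "C1_norm K f = max (C0_norm K f) (MAX k. C0_norm K (partial k f))"

end

(*
  For rational b = Q/P, let x^t be the least minimiser of the periodic action lying above the line
  i |-> b i + t. Then psi(t) = x^t_0 is a hull function (monotone, psi(t + 1) = psi(t) + 1) with
  x^t_i = psi(b i + t), so minimisers may be taken well-ordered; a minimiser subject to x_0 = xi can be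
  squeezed between two of them, because the action is submodular for max and min. Hence all relevant
  sequences have a bound on their increments that depends on the rotation number only, which settles
  rational rotation numbers: a perturbation of size delta changes the barrier at q/p by at most 2 p delta.

  For irrational omega one needs a modulus of continuity of the barrier in the rotation number that is
  uniform in the potential. Let a = q/p with |a - omega| < 1/p^2 and let b be much closer to omega.
  Averaged over t, the action per site of psi(a i + t) and of psi(b i + t) differ by O(|a - b|), so for some
  theta the orbit psi(a i + theta) of the hull function of b is a minimiser for a up to O(1/p).
  Near 0, over a length p, the sequences psi(a i + t) and psi(b i + t) are trapped in strips whose gaps
  add up to a constant, hence are O(1/p)-close at some place. Exchanging blocks of length p between
  (constrained) minimisers for a and for b there gives |P_a(xi) - P_b(xi)| = O(1/p), with a constant
  depending only on r and on a Lipschitz constant of the potential.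
*)
theory Submission
  imports Defs
begin

section \<open>Calculus of potentials\<close>


lemma has_derivative_partial:
  fixes f :: "real ^ 'n::finite \<Rightarrow> real"
  assumes "f differentiable (at x)"
  shows "(f has_derivative (\<lambda>h. \<Sum>k\<in>UNIV. h $ k * partial k f x)) (at x)"
proof -
  obtain D where D: "(f has_derivative D) (at x)"
    using assms unfolding differentiable_def by blast
  interpret bounded_linear D using D by (rule has_derivative_bounded_linear)
  have ax: "partial k f x = D (axis k 1)" for k
  proof -
    have g: "((\<lambda>t. x + t *\<^sub>R axis k 1) has_derivative (\<lambda>t. t *\<^sub>R axis k 1)) (at (0::real))"
      by (auto intro!: derivative_eq_intros)
    have "((\<lambda>t. f (x + t *\<^sub>R axis k 1)) has_derivative (\<lambda>t. D (t *\<^sub>R axis k 1))) (at (0::real))"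
      using has_derivative_compose[OF g, of f D] D by simp
    then have "((\<lambda>t. f (x + t *\<^sub>R axis k 1)) has_real_derivative D (axis k 1)) (at (0::real))"
      unfolding has_field_derivative_def by (simp add: scaleR mult.commute[of _ "D (axis k 1)"])
    then show ?thesis unfolding partial_def by (rule DERIV_imp_deriv)
  qed
  have "D h = (\<Sum>k\<in>UNIV. h $ k * partial k f x)" for h
  proof -
    have "D h = D (\<Sum>k\<in>UNIV. h $ k *\<^sub>R axis k 1)"
      using basis_expansion[of h] by (simp add: scalar_mult_eq_scaleR)
    then show ?thesis by (simp add: sum scaleR ax)
  qed
  then have "D = (\<lambda>h. \<Sum>k\<in>UNIV. h $ k * partial k f x)" by blast
  with D show ?thesis by simp
qed

lemma has_real_derivative_line:
  fixes f :: "real ^ 'n::finite \<Rightarrow> real"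
  assumes "\<And>x. f differentiable (at x)"
  shows "((\<lambda>t. f (u + t *\<^sub>R h)) has_real_derivative
           (\<Sum>k\<in>UNIV. h $ k * partial k f (u + t *\<^sub>R h))) (at t)"
proof -
  have g: "((\<lambda>t. u + t *\<^sub>R h) has_derivative (\<lambda>s. s *\<^sub>R h)) (at t)"
    by (auto intro!: derivative_eq_intros)
  have "((\<lambda>t. f (u + t *\<^sub>R h)) has_derivative
      (\<lambda>s. \<Sum>k\<in>UNIV. (s *\<^sub>R h) $ k * partial k f (u + t *\<^sub>R h))) (at t)"
    by (rule has_derivative_compose[OF g has_derivative_partial[OF assms]])
  moreover have "(\<lambda>s. \<Sum>k\<in>UNIV. (s *\<^sub>R h) $ k * partial k f (u + t *\<^sub>R h)) =
      (*) (\<Sum>k\<in>UNIV. h $ k * partial k f (u + t *\<^sub>R h))"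
    by (simp add: fun_eq_iff sum_distrib_left ac_simps)
  ultimately show ?thesis unfolding has_field_derivative_def by simp
qed

text \<open>The lattice form of condition B. Unlike a sign condition on second derivatives it can be
  summed over windows, which is what makes truncation by max and min compatible with the
  action.\<close>

definition submodular :: "(real ^ 'n::finite \<Rightarrow> real) \<Rightarrow> bool" where
  "submodular S \<longleftrightarrow> (\<forall>u v. S (\<chi> i. max (u $ i) (v $ i)) + S (\<chi> i. min (u $ i) (v $ i)) \<le> S u + S v)"

text \<open>Write \<open>u = m + a\<close> and \<open>v = m + b\<close> with \<open>m\<close> the
  minimum; then \<open>a\<close> and \<open>b\<close> are non-negative with disjoint supports. The
  increment of \<open>S\<close> caused by adding \<open>a\<close> is non-increasing along
  \<open>b\<close>, because its derivative there is an integral of mixed second derivatives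
  only.\<close>

lemma condB_submodular:
  fixes S :: "real ^ 'n::{finite,linorder} \<Rightarrow> real"
  assumes "condB S"
  shows "submodular S"
  unfolding submodular_def
proof (intro allI)
  fix u v :: "(real, 'n) vec"
  define m a b :: "(real, 'n) vec" where "m = (\<chi> i. min (u $ i) (v $ i))"
    and "a = u - m" and "b = v - m"
  have d1: "S differentiable (at x)" and d2: "partial k S differentiable (at x)" for k x
    using assms unfolding condB_def is_C2_def is_C1_def by auto
  have neg: "partial i (partial k S) x \<le> 0" if "i \<noteq> k" for i k x
    using assms that unfolding condB_def by auto
  have ab: "a $ i \<ge> 0" "b $ i \<ge> 0" "a $ i = 0 \<or> b $ i = 0" for i
    by (auto simp: a_def b_def m_def min_def)
  have inner: "b $ k * partial k S (m + a + t *\<^sub>R b) \<le> b $ k * partial k S (m + t *\<^sub>R b)" for k t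
  proof (cases "b $ k = 0")
    case False
    then have ak: "a $ k = 0" using ab by blast
    \<comment> \<open>Since \<open>a $ k = 0\<close>, moving along \<open>a\<close> changes
      \<open>partial k S\<close> only through \<open>partial i (partial k S)\<close> with i \<noteq>
      k.\<close>
    have "partial k S ((m + t *\<^sub>R b) + 1 *\<^sub>R a) \<le> partial k S ((m + t *\<^sub>R b) + 0 *\<^sub>R a)"
    proof (rule DERIV_nonpos_imp_nonincreasing[of 0 1 "\<lambda>s. partial k S ((m + t *\<^sub>R b) + s *\<^sub>R a)"])
      fix s :: real
      have "(\<Sum>i\<in>UNIV. a $ i * partial i (partial k S) ((m + t *\<^sub>R b) + s *\<^sub>R a)) \<le> 0"
      proof (rule sum_nonpos)
        fix i
        show "a $ i * partial i (partial k S) ((m + t *\<^sub>R b) + s *\<^sub>R a) \<le> 0"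
          using ab(1)[of i] ak neg[of i k] by (cases "i = k") (auto intro: mult_nonneg_nonpos)
      qed
      then show "\<exists>y. ((\<lambda>s. partial k S ((m + t *\<^sub>R b) + s *\<^sub>R a)) has_real_derivative y) (at s) \<and> y \<le> 0"
        using has_real_derivative_line[OF d2] by blast
    qed simp
    then have "partial k S (m + a + t *\<^sub>R b) \<le> partial k S (m + t *\<^sub>R b)"
      by (simp add: algebra_simps)
    then show ?thesis using ab(2) by (rule mult_left_mono)
  qed simp
  have "S ((m + a) + 1 *\<^sub>R b) - S (m + 1 *\<^sub>R b) \<le> S ((m + a) + 0 *\<^sub>R b) - S (m + 0 *\<^sub>R b)"
  proof (rule DERIV_nonpos_imp_nonincreasing[of 0 1 "\<lambda>t. S ((m + a) + t *\<^sub>R b) - S (m + t *\<^sub>R b)"])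
    fix t :: real
    have "((\<lambda>t. S ((m + a) + t *\<^sub>R b) - S (m + t *\<^sub>R b)) has_real_derivative
        (\<Sum>k\<in>UNIV. b $ k * partial k S (m + a + t *\<^sub>R b)) -
        (\<Sum>k\<in>UNIV. b $ k * partial k S (m + t *\<^sub>R b))) (at t)"
      by (intro DERIV_diff has_real_derivative_line d1)
    moreover have "(\<Sum>k\<in>UNIV. b $ k * partial k S (m + a + t *\<^sub>R b)) \<le>
        (\<Sum>k\<in>UNIV. b $ k * partial k S (m + t *\<^sub>R b))"
      by (rule sum_mono) (rule inner)
    ultimately show "\<exists>y. ((\<lambda>t. S ((m + a) + t *\<^sub>R b) - S (m + t *\<^sub>R b))
        has_real_derivative y) (at t) \<and> y \<le> 0"
      by fastforce
  qed simp
  then have "S (m + a + b) + S m \<le> S (m + a) + S (m + b)" by simp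
  moreover have "m + a = u" "m + b = v" by (auto simp: a_def b_def)
  moreover have "m + a + b = (\<chi> i. max (u $ i) (v $ i))"
    by (auto simp: a_def b_def m_def vec_eq_iff max_def min_def)
  ultimately show "S (\<chi> i. max (u $ i) (v $ i)) + S (\<chi> i. min (u $ i) (v $ i)) \<le> S u + S v"
    unfolding m_def by simp
qed

lemma is_C1_continuous: "is_C1 S \<Longrightarrow> continuous_on UNIV S"
  unfolding is_C1_def
  by (metis differentiable_imp_continuous_on differentiable_at_imp_differentiable_on)

section \<open>Lipschitz bounds on windows of sequences with bounded increments\<close>

definition lip_const :: "real \<Rightarrow> real \<Rightarrow> (real ^ 'n::{finite,linorder} \<Rightarrow> real) \<Rightarrow> bool" where
  "lip_const K L S \<longleftrightarrow> (\<forall>x y j. x \<in> lip_seqs K \<longrightarrow> y \<in> lip_seqs K \<longrightarrow>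
     \<bar>S (window x j) - S (window y j)\<bar> \<le> L * (\<Sum>i::'n\<in>UNIV. \<bar>x (j + int (pos i)) - y (j + int (pos i))\<bar>))"

lemma lip_constD:
  fixes S :: "real ^ 'n::{finite,linorder} \<Rightarrow> real"
  assumes "lip_const K L S" "x \<in> lip_seqs K" "y \<in> lip_seqs K"
  shows "\<bar>S (window x j) - S (window y j)\<bar>
    \<le> L * (\<Sum>i::'n\<in>UNIV. \<bar>x (j + int (pos i)) - y (j + int (pos i))\<bar>)"
  using assms unfolding lip_const_def by blast

lemma window_shift: "window x j = window (\<lambda>i. x (i + j)) 0"
  by (simp add: window_def add.commute)

lemma lip_seqs_shift: "x \<in> lip_seqs K \<Longrightarrow> (\<lambda>i. x (i + j)) \<in> lip_seqs K"
  unfolding lip_seqs_def by (auto simp: algebra_simps) (metis add.commute add.left_commute)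

text \<open>Mean value theorem on the segment joining two windows. As \<open>lip_seqs K\<close> is
  convex and shift invariant, every point of the segment is again a window at 0 of such a sequence.
  The restriction to these windows matters: a coercive potential need not be globally
  Lipschitz.\<close>

lemma lip_constI:
  fixes f :: "real ^ 'n::{finite,linorder} \<Rightarrow> real"
  assumes d: "\<And>x. f differentiable (at x)"
    and b: "\<And>k x. x \<in> lip_seqs K \<Longrightarrow> \<bar>partial k f (window x 0)\<bar> \<le> L"
  shows "lip_const K L f"
  unfolding lip_const_def
proof (intro allI impI)
  fix x y :: "int \<Rightarrow> real" and j
  assume x: "x \<in> lip_seqs K" and y: "y \<in> lip_seqs K"
  let ?u = "window y j :: (real, 'n) vec" and ?h = "window x j - window y j :: (real, 'n) vec"
  have pb: "\<bar>partial k f (?u + t *\<^sub>R ?h)\<bar> \<le> L" if "0 \<le> t" "t \<le> 1" for k t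
  proof -
    define z where "z i = (1 - t) * y (i + j) + t * x (i + j)" for i
    have "z \<in> lip_seqs K"
      unfolding lip_seqs_def
    proof (intro CollectI allI)
      fix i
      have e: "\<bar>y (i + 1 + j) - y (i + j)\<bar> \<le> K" "\<bar>x (i + 1 + j) - x (i + j)\<bar> \<le> K"
        using lip_seqs_shift[OF x, of j] lip_seqs_shift[OF y, of j] by (auto simp: lip_seqs_def)
      have "z (i + 1) - z i = (1 - t) * (y (i + 1 + j) - y (i + j)) + t * (x (i + 1 + j) - x (i + j))"
        by (simp add: z_def algebra_simps)
      also have "\<bar>\<dots>\<bar> \<le> (1 - t) * K + t * K"
        using that e by (intro order.trans[OF abs_triangle_ineq] add_mono)
          (auto simp: abs_mult intro!: mult_left_mono)
      finally show "\<bar>z (i + 1) - z i\<bar> \<le> K" by (simp add: algebra_simps)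
    qed
    moreover have "?u + t *\<^sub>R ?h = window z 0"
      by (simp add: window_def z_def vec_eq_iff algebra_simps)
    ultimately show ?thesis using b by metis
  qed
  obtain t where t: "0 < t" "t < 1" and
    eq: "f (?u + 1 *\<^sub>R ?h) - f (?u + 0 *\<^sub>R ?h) = (1 - 0) * (\<Sum>k\<in>UNIV. ?h $ k * partial k f (?u + t *\<^sub>R ?h))"
    using MVT2[of 0 1 "\<lambda>t. f (?u + t *\<^sub>R ?h)", OF _ has_real_derivative_line[OF d]] by auto
  have "\<bar>f (window x j) - f (window y j)\<bar> = \<bar>\<Sum>k\<in>UNIV. ?h $ k * partial k f (?u + t *\<^sub>R ?h)\<bar>"
    using eq by simp
  also have "\<dots> \<le> (\<Sum>k\<in>UNIV. \<bar>?h $ k\<bar> * L)"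
    using pb t by (intro order.trans[OF sum_abs] sum_mono) (auto simp: abs_mult intro!: mult_left_mono)
  also have "\<dots> = L * (\<Sum>i::'n\<in>UNIV. \<bar>x (j + int (pos i)) - y (j + int (pos i))\<bar>)"
    by (simp add: window_def sum_distrib_left mult.commute)
  finally show "\<bar>f (window x j) - f (window y j)\<bar>
      \<le> L * (\<Sum>i::'n\<in>UNIV. \<bar>x (j + int (pos i)) - y (j + int (pos i))\<bar>)" .
qed

lemma pos_less_card: "pos (i::'n::{finite,linorder}) < CARD('n)"
  unfolding pos_def by (rule psubset_card_mono) auto

lemma lip_seqs_bound:
  assumes "x \<in> lip_seqs K"
  shows "\<bar>x (i + int n) - x i\<bar> \<le> K * real n"
proof (induction n)
  case (Suc n)
  have "\<bar>x (i + int n + 1) - x (i + int n)\<bar> \<le> K" using assms by (simp add: lip_seqs_def)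
  with Suc show ?case by (simp add: algebra_simps)
qed simp

lemma condA_int:
  fixes S :: "real ^ 'n::{finite,linorder} \<Rightarrow> real"
  assumes "condA S"
  shows "S (\<chi> i. x $ i + of_int m) = S x"
proof (induction m rule: int_induct[where k = 0])
  case base show ?case by simp
next
  case (step1 i)
  then show ?case using assms[unfolded condA_def, rule_format, of "\<chi> j. x $ j + of_int i"]
    by (simp add: add.assoc)
next
  case (step2 i)
  then show ?case using assms[unfolded condA_def, rule_format, of "\<chi> j. x $ j + of_int (i - 1)"]
    by (simp add: add.assoc)
qed

lemma window_add_int: "window (\<lambda>i. x i + c) j = (\<chi> i. window x j $ i + c)"
  by (simp add: window_def)

lemma partial_condA:
  fixes S :: "real ^ 'n::{finite,linorder} \<Rightarrow> real"
  assumes "condA S"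
  shows "partial k S (\<chi> i. x $ i + of_int m) = partial k S x"
proof -
  have "S ((\<chi> i. x $ i + of_int m) + t *\<^sub>R axis k 1) = S (x + t *\<^sub>R axis k 1)" for t
    using condA_int[OF assms, of "x + t *\<^sub>R axis k 1" m]
    by (simp add: plus_vec_def algebra_simps)
  then show ?thesis unfolding partial_def by simp
qed

text \<open>Subtracting the integer part of \<open>x 0\<close> moves any window of a sequence in
  \<open>lip_seqs K\<close> into one fixed box, and by condition A this leaves the partial
  derivatives unchanged; compactness does the rest.\<close>

lemma partial_bounded:
  fixes S :: "real ^ 'n::{finite,linorder} \<Rightarrow> real"
  assumes A: "condA S" and C: "is_C1 S"
  obtains L where "L \<ge> 0" "\<And>k x. x \<in> lip_seqs K \<Longrightarrow> \<bar>partial k S (window x 0)\<bar> \<le> L"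
proof -
  let ?B = "1 + \<bar>K\<bar> * real CARD('n)"
  let ?c = "cbox (\<chi> i. - ?B) (\<chi> i. ?B) :: ((real, 'n) vec) set"
  have "\<exists>b. \<forall>y\<in>?c. \<bar>partial k S y\<bar> \<le> b" for k
  proof -
    have "compact (partial k S ` ?c)"
      by (rule compact_continuous_image) (use C in \<open>auto simp: is_C1_def intro: continuous_on_subset\<close>)
    then have "bounded (partial k S ` ?c)" by (rule compact_imp_bounded)
    then show ?thesis unfolding bounded_iff by auto
  qed
  then obtain b where b: "\<And>k y. y \<in> ?c \<Longrightarrow> \<bar>partial k S y\<bar> \<le> b k" by metis
  define L where "L = (\<Sum>k\<in>UNIV. \<bar>b k\<bar>)"
  have "\<bar>partial k S (window x 0)\<bar> \<le> L" if x: "x \<in> lip_seqs K" for k x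
  proof -
    let ?y = "(\<chi> i. window x 0 $ i + of_int (- \<lfloor>x 0\<rfloor>)) :: (real, 'n) vec"
    have "?y \<in> ?c"
    proof -
      have "\<bar>x (int (pos i)) - of_int \<lfloor>x 0\<rfloor>\<bar> \<le> ?B" for i :: 'n
      proof -
        have "\<bar>x (int (pos i)) - x 0\<bar> \<le> K * real (pos i)"
          using lip_seqs_bound[OF x, of 0 "pos i"] by simp
        also have "\<dots> \<le> \<bar>K\<bar> * real CARD('n)"
          using pos_less_card[of i] by (intro mult_mono) auto
        finally show ?thesis by linarith
      qed
      then show ?thesis by (auto simp: mem_box_cart window_def abs_le_iff) (smt (verit))+
    qed
    then have "\<bar>partial k S ?y\<bar> \<le> b k" by (rule b)
    also have "\<dots> \<le> \<bar>b k\<bar>" by simp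
    also have "\<dots> \<le> L" unfolding L_def by (rule member_le_sum) auto
    finally show ?thesis using partial_condA[OF A] by metis
  qed
  then show ?thesis using that[of L] unfolding L_def by (simp add: sum_nonneg)
qed

section \<open>Periodic sequences and minimisers\<close>


lemma sum_period:
  fixes f :: "int \<Rightarrow> real"
  assumes "\<And>i. f (i + p) = f i" "p > 0"
  shows "(\<Sum>i\<in>{s..<s + p}. f i) = (\<Sum>i\<in>{0..<p}. f i)"
proof -
  have step: "(\<Sum>i\<in>{s + 1..<s + 1 + p}. f i) = (\<Sum>i\<in>{s..<s + p}. f i)" for s
  proof -
    have "{s..<s + p} = insert s {s + 1..<s + p}" "{s + 1..<s + 1 + p} = insert (s + p) {s + 1..<s + p}"
      using \<open>p > 0\<close> by auto
    then show ?thesis using assms(1)[of s] by simp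
  qed
  show ?thesis
  proof (induction s rule: int_induct[where k = 0])
    case (step1 i) then show ?case using step[of i] by simp
  next
    case (step2 i) then show ?case using step[of "i - 1"] by simp
  qed simp
qed

lemma per_seqsD: "x \<in> per_seqs p q \<Longrightarrow> x (i + p) = x i + of_int q"
  unfolding per_seqs_def by (drule CollectD) (drule spec[of _ "i + p"], simp)

lemma per_seqsI:
  assumes "\<And>i. x (i + p) = x i + of_int q"
  shows "x \<in> per_seqs p q"
  unfolding per_seqs_def
proof (intro CollectI allI)
  fix i
  show "x (i - p) + of_int q = x i" using assms[of "i - p"] by simp
qed

lemma per_seqs_mult:
  assumes "x \<in> per_seqs p q"
  shows "x (i + k * p) = x i + of_int (k * q)"
proof (induction k rule: int_induct[where k = 0])
  case (step1 k)
  then show ?case using per_seqsD[OF assms, of "i + k * p"] by (simp add: algebra_simps)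
next
  case (step2 k)
  then show ?case using per_seqsD[OF assms, of "i + (k - 1) * p"] by (simp add: algebra_simps)
qed simp

lemma per_seqs_div_mod:
  assumes "x \<in> per_seqs p q"
  shows "x i = x (s + (i - s) mod p) + of_int ((i - s) div p * q)"
proof -
  have "s + (i - s) mod p + (i - s) div p * p = i" by (simp add: algebra_simps)
  then show ?thesis using per_seqs_mult[OF assms, of "s + (i - s) mod p" "(i - s) div p"] by simp
qed

lemma per_seqs_eqI:
  assumes "x \<in> per_seqs p q" "y \<in> per_seqs p q" "p > 0" "\<And>i. 0 \<le> i \<Longrightarrow> i < p \<Longrightarrow> x i = y i"
  shows "x = y"
proof
  fix i
  show "x i = y i"
    using per_seqs_div_mod[OF assms(1), of i 0] per_seqs_div_mod[OF assms(2), of i 0] assms(3,4)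
    by simp
qed

lemma per_seqs_shift:
  assumes "x \<in> per_seqs p q"
  shows "(\<lambda>i. x (i + k) + c) \<in> per_seqs p q"
proof (rule per_seqsI)
  fix i
  show "x (i + p + k) + c = x (i + k) + c + of_int q"
    using per_seqsD[OF assms, of "i + k"] by (simp add: ac_simps)
qed

lemma per_seqs_max:
  "x \<in> per_seqs p q \<Longrightarrow> y \<in> per_seqs p q \<Longrightarrow> (\<lambda>i. max (x i) (y i)) \<in> per_seqs p q"
  by (rule per_seqsI) (simp add: per_seqsD)

lemma per_seqs_min:
  "x \<in> per_seqs p q \<Longrightarrow> y \<in> per_seqs p q \<Longrightarrow> (\<lambda>i. min (x i) (y i)) \<in> per_seqs p q"
  by (rule per_seqsI) (simp add: per_seqsD)

text \<open>The last windows also see up to \<open>CARD('n) - 1\<close> sites from \<open>e\<close>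
  onwards; this overhang is the source of the errors when blocks are exchanged.\<close>

definition energy :: "(real ^ 'n::{finite,linorder} \<Rightarrow> real) \<Rightarrow> (int \<Rightarrow> real) \<Rightarrow> int \<Rightarrow> int \<Rightarrow> real" where
  "energy S x s e = (\<Sum>j\<in>{s..<e}. S (window x j))"

section \<open>Existence of periodic minimisers by the direct method\<close>

lemma closed_per_seqs: "closed (per_seqs p q)"
  unfolding per_seqs_def
  by (intro closed_Collect_all closed_Collect_eq continuous_intros continuous_on_product_coordinates)

lemma compact_box:
  fixes B :: "int \<Rightarrow> real"
  shows "compact {x. \<forall>i. A i \<le> x i \<and> x i \<le> B i}"
proof -
  have "{x. \<forall>i. A i \<le> x i \<and> x i \<le> B i} = PiE UNIV (\<lambda>i. {A i..B i})"
    by (auto simp: PiE_def Pi_def)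
  moreover have "compactin (product_topology (\<lambda>i. euclidean) UNIV) (PiE UNIV (\<lambda>i. {A i..B i}))"
    by (subst compactin_PiE) auto
  ultimately show ?thesis
    by (simp add: euclidean_product_topology)
qed

text \<open>\<open>LEAST\<close> on the reals is informative only for an attained minimum; this
  identifies the two terms of the Peierls barrier with actions of minimisers.\<close>

lemma Least_image_eq:
  fixes f :: "'a \<Rightarrow> real"
  assumes "x \<in> X" "\<And>y. y \<in> X \<Longrightarrow> f x \<le> f y"
  shows "(LEAST w. w \<in> f ` X) = f x"
  by (rule Least_equality) (use assms in auto)

locale potential =
  fixes S :: "real ^ 'n::{finite,linorder} \<Rightarrow> real"
  assumes periodic: "condA S" and sub: "submodular S"
    and cont: "continuous_on UNIV S" and coercive: "condC S"
begin

lemma window_of_int: "S (window (\<lambda>i. x i + of_int m) j) = S (window x j)"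
  unfolding window_add_int by (rule condA_int[OF periodic])

lemma window_per:
  assumes "x \<in> per_seqs p q"
  shows "S (window x (j + p)) = S (window x j)"
proof -
  have "window x (j + p) = (window (\<lambda>i. x i + of_int q) j :: (real, 'n) vec)"
  proof -
    have "x (j + p + int (pos i)) = x (j + int (pos i)) + of_int q" for i :: 'n
      using per_seqsD[OF assms, of "j + int (pos i)"] by (simp add: ac_simps)
    then show ?thesis by (simp add: window_def vec_eq_iff)
  qed
  then show ?thesis using window_of_int by metis
qed

lemma energy_period:
  assumes "x \<in> per_seqs p q" "p > 0"
  shows "energy S x s (s + p) = per_action S p x"
  unfolding energy_def per_action_def
  by (rule sum_period) (use window_per[OF assms(1)] assms(2) in auto)

lemma per_action_shift:
  assumes "x \<in> per_seqs p q" "p > 0"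
  shows "per_action S p (\<lambda>i. x (i + k) + of_int l) = per_action S p x"
proof -
  have "per_action S p (\<lambda>i. x (i + k) + of_int l) = (\<Sum>j\<in>{0..<p}. S (window x (j + k)))"
    unfolding per_action_def
    by (simp add: window_of_int[of "\<lambda>i. x (i + k)"]) (simp add: window_def ac_simps)
  also have "\<dots> = energy S x k (k + p)"
    unfolding energy_def
    by (rule sum.reindex_bij_witness[of _ "\<lambda>j. j - k" "\<lambda>j. j + k"]) auto
  finally show ?thesis using energy_period[OF assms] by simp
qed

lemma per_action_max_min:
  "per_action S p (\<lambda>i. max (x i) (y i)) + per_action S p (\<lambda>i. min (x i) (y i))
    \<le> per_action S p x + per_action S p y"
  unfolding per_action_def sum.distrib[symmetric]
proof (rule sum_mono)
  fix j
  have "window (\<lambda>i. max (x i) (y i)) j = (\<chi> i. max (window x j $ i) (window y j $ i) :: (real, 'n) vec)"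
    "window (\<lambda>i. min (x i) (y i)) j = (\<chi> i. min (window x j $ i) (window y j $ i) :: (real, 'n) vec)"
    by (simp_all add: window_def)
  then show "S (window (\<lambda>i. max (x i) (y i)) j) + S (window (\<lambda>i. min (x i) (y i)) j)
      \<le> S (window x j) + S (window y j)"
    using sub unfolding submodular_def by metis
qed

lemma continuous_per_action: "continuous_on X (per_action S p)"
  unfolding per_action_def window_def
  by (intro continuous_on_sum continuous_on_compose2[OF cont] continuous_on_vec_lambda
      continuous_on_subset[OF continuous_on_product_coordinates]) auto

text \<open>Every increment of \<open>x\<close> occurs at the coercive pair of positions in some
  window. A large increment makes that window expensive, and the remaining windows of the period
  cannot compensate because \<open>S\<close> is bounded below.\<close>

lemma per_action_coercive:
  assumes "p > 0"
  obtains R where "R \<ge> 0" "\<And>x. x \<in> per_seqs p q \<Longrightarrow> per_action S p x \<le> T \<Longrightarrow> x \<in> lip_seqs R"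
proof -
  obtain m where m: "\<And>v. m \<le> S v"
    using coercive unfolding condC_def bdd_below_def by auto
  obtain k l where kl: "pos l = pos (k::'n) + 1"
    and lim: "filterlim S at_top (filtercomap (\<lambda>x. \<bar>x $ l - x $ k\<bar>) at_top)"
    using coercive unfolding condC_def by blast
  \<comment> \<open>The other windows lower the action by at most \<open>p * \<bar>m\<bar>\<close>;
    the extra 1 makes the contradiction strict.\<close>
  define T' where "T' = T + of_int p * \<bar>m\<bar> + 1"
  from lim have "eventually (\<lambda>v. T' \<le> S v) (filtercomap (\<lambda>x. \<bar>x $ l - x $ k\<bar>) at_top)"
    unfolding filterlim_at_top by blast
  then obtain N where N: "\<And>v. \<bar>v $ l - v $ k\<bar> \<ge> N \<Longrightarrow> T' \<le> S v"
    unfolding eventually_filtercomap_at_top_linorder by blast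
  have "x \<in> lip_seqs \<bar>N\<bar>" if x: "x \<in> per_seqs p q" and T: "per_action S p x \<le> T" for x
    unfolding lip_seqs_def
  proof (intro CollectI allI)
    fix i
    define j where "j = i - int (pos k)"
    show "\<bar>x (i + 1) - x i\<bar> \<le> \<bar>N\<bar>"
    proof (rule ccontr)
      assume "\<not> ?thesis"
      then have "\<bar>window x j $ l - window x j $ k\<bar> \<ge> N"
        by (simp add: window_def j_def kl algebra_simps)
      then have big: "T' \<le> S (window x j)" by (rule N)
      have "energy S x j (j + p) = S (window x j) + (\<Sum>j\<in>{j + 1..<j + p}. S (window x j))"
      proof -
        have "{j..<j + p} = insert j {j + 1..<j + p}" using assms by auto
        then show ?thesis unfolding energy_def by simp
      qed
      moreover have "(\<Sum>j\<in>{j + 1..<j + p}. S (window x j)) \<ge> (\<Sum>j\<in>{j + 1..<j + p}. - \<bar>m\<bar>)"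
        by (intro sum_mono) (use m in \<open>smt (verit)\<close>)
      moreover have "(\<Sum>j\<in>{j + 1..<j + p}. - \<bar>m\<bar>) \<ge> - (of_int p * \<bar>m\<bar>)"
        using assms by (simp add: mult_right_mono)
      ultimately have "energy S x j (j + p) \<ge> T' - of_int p * \<bar>m\<bar>" using big by linarith
      then show False using energy_period[OF x assms] T unfolding T'_def by simp
    qed
  qed
  then show ?thesis using that[of "\<bar>N\<bar>"] by auto
qed

lemma affine_per_seqs: "p > 0 \<Longrightarrow> (\<lambda>i. of_int q / of_int p * of_int i + c) \<in> per_seqs p q"
  by (rule per_seqsI) (simp add: field_simps)

text \<open>One existence result for both minima: \<open>\<alpha> = \<beta>\<close> gives the
  constrained problem, and the interval from 0 to 1 gives the free one up to integer
  translation.\<close>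

lemma minimiser_interval:
  assumes p: "p > 0" and "\<alpha> \<le> \<beta>"
  shows "\<exists>x\<in>{x \<in> per_seqs p q. \<alpha> \<le> x 0 \<and> x 0 \<le> \<beta>}.
    \<forall>y\<in>{x \<in> per_seqs p q. \<alpha> \<le> x 0 \<and> x 0 \<le> \<beta>}. per_action S p x \<le> per_action S p y"
proof -
  let ?X = "{x \<in> per_seqs p q. \<alpha> \<le> x 0 \<and> x 0 \<le> \<beta>}"
  \<comment> \<open>The affine sequence is an admissible competitor, so only the sublevel set of its
    action has to be compact.\<close>
  define x0 where "x0 i = of_int q / of_int p * of_int i + \<alpha>" for i :: int
  have x0: "x0 \<in> ?X"
    using affine_per_seqs[OF p, of q \<alpha>] \<open>\<alpha> \<le> \<beta>\<close> by (simp add: x0_def[abs_def])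
  obtain R where "R \<ge> 0" and R: "\<And>x. x \<in> per_seqs p q \<Longrightarrow> per_action S p x \<le> per_action S p x0 \<Longrightarrow> x \<in> lip_seqs R"
    using per_action_coercive[OF p, of q "per_action S p x0"] by blast
  define B where "B i = \<bar>\<alpha>\<bar> + \<bar>\<beta>\<bar> + R * \<bar>of_int i\<bar>" for i :: int
  define K where "K = {x. \<forall>i. - B i \<le> x i \<and> x i \<le> B i} \<inter> ?X"
  have inK: "x \<in> K" if "x \<in> ?X" "per_action S p x \<le> per_action S p x0" for x
  proof -
    have "x \<in> lip_seqs R" using R that by auto
    have "\<bar>x i - x 0\<bar> \<le> R * \<bar>of_int i\<bar>" for i
    proof (cases "i \<ge> 0")
      case True
      then show ?thesis using lip_seqs_bound[OF \<open>x \<in> lip_seqs R\<close>, of 0 "nat i"] by simp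
    next
      case False
      then show ?thesis using lip_seqs_bound[OF \<open>x \<in> lip_seqs R\<close>, of i "nat (- i)"]
        by (simp add: abs_minus_commute)
    qed
    moreover have "\<bar>x 0\<bar> \<le> \<bar>\<alpha>\<bar> + \<bar>\<beta>\<bar>" using that by auto
    ultimately have "- B i \<le> x i \<and> x i \<le> B i" for i
      unfolding B_def by (smt (verit, best))
    then show ?thesis using that unfolding K_def by blast
  qed
  have "closed ?X"
    by (intro closed_Collect_conj closed_Collect_le continuous_intros continuous_on_product_coordinates)
      (use closed_per_seqs in simp)
  then have "compact K" unfolding K_def by (intro compact_Int_closed compact_box)
  moreover have "K \<noteq> {}" using inK[OF x0] by auto
  ultimately obtain x where x: "x \<in> K" "\<And>y. y \<in> K \<Longrightarrow> per_action S p x \<le> per_action S p y"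
    using continuous_attains_inf[OF _ _ continuous_per_action] by metis
  show ?thesis
  proof (intro bexI ballI)
    show "x \<in> ?X" using x(1) unfolding K_def by blast
    fix y assume "y \<in> ?X"
    then show "per_action S p x \<le> per_action S p y"
      using x(2)[of y] x(2)[OF inK[OF x0]] inK[of y] by fastforce
  qed
qed

definition min_action :: "int \<Rightarrow> int \<Rightarrow> real" where
  "min_action p q = (LEAST w. w \<in> per_action S p ` per_seqs p q)"

definition min_action_at :: "int \<Rightarrow> int \<Rightarrow> real \<Rightarrow> real" where
  "min_action_at p q \<xi> = (LEAST w. w \<in> per_action S p ` {x \<in> per_seqs p q. x 0 = \<xi>})"

lemma min_action:
  assumes p: "p > 0"
  obtains x where "x \<in> per_seqs p q" "per_action S p x = min_action p q"
    "\<And>y. y \<in> per_seqs p q \<Longrightarrow> min_action p q \<le> per_action S p y"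
proof -
  obtain x where x: "x \<in> per_seqs p q"
    and m: "\<And>y. y \<in> per_seqs p q \<Longrightarrow> 0 \<le> y 0 \<Longrightarrow> y 0 \<le> 1 \<Longrightarrow> per_action S p x \<le> per_action S p y"
    using minimiser_interval[OF p, of 0 1 q] by auto
  have m': "per_action S p x \<le> per_action S p y" if y: "y \<in> per_seqs p q" for y
    using m[OF per_seqs_shift[OF y, of 0 "of_int (- \<lfloor>y 0\<rfloor>)"]] per_action_shift[OF y p, of 0 "- \<lfloor>y 0\<rfloor>"]
    by (simp) linarith
  have "min_action p q = per_action S p x"
    unfolding min_action_def by (rule Least_image_eq) (use x m' in auto)
  with x m' that show ?thesis by metis
qed

lemma min_action_le: "p > 0 \<Longrightarrow> y \<in> per_seqs p q \<Longrightarrow> min_action p q \<le> per_action S p y"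
  by (metis min_action)

lemma min_action_at:
  assumes p: "p > 0"
  obtains x where "x \<in> per_seqs p q" "x 0 = \<xi>" "per_action S p x = min_action_at p q \<xi>"
    "\<And>y. y \<in> per_seqs p q \<Longrightarrow> y 0 = \<xi> \<Longrightarrow> min_action_at p q \<xi> \<le> per_action S p y"
proof -
  obtain x where x: "x \<in> per_seqs p q" "x 0 = \<xi>"
    and m: "\<And>y. y \<in> per_seqs p q \<Longrightarrow> y 0 = \<xi> \<Longrightarrow> per_action S p x \<le> per_action S p y"
    using minimiser_interval[OF p, of \<xi> \<xi> q] by auto
  have "min_action_at p q \<xi> = per_action S p x"
    unfolding min_action_at_def by (rule Least_image_eq) (use x m in auto)
  with x m that show ?thesis by metis
qed

lemma min_action_at_le:
  "p > 0 \<Longrightarrow> y \<in> per_seqs p q \<Longrightarrow> y 0 = \<xi> \<Longrightarrow> min_action_at p q \<xi> \<le> per_action S p y"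
  by (metis min_action_at)

lemma peierls_rat_eq:
  "quotient_of a = (q, p) \<Longrightarrow> peierls_rat S a \<xi> = min_action_at p q \<xi> - min_action p q"
  unfolding peierls_rat_def min_action_def min_action_at_def by simp

end

section \<open>Hull functions\<close>


definition hull_fun :: "(real \<Rightarrow> real) \<Rightarrow> bool" where
  "hull_fun \<phi> \<longleftrightarrow> mono \<phi> \<and> (\<forall>t. \<phi> (t + 1) = \<phi> t + 1)"

text \<open>The slope \<open>a\<close> is a free parameter: the hull function of one rotation number
  is later evaluated along orbits of another.\<close>

definition orb :: "(real \<Rightarrow> real) \<Rightarrow> real \<Rightarrow> real \<Rightarrow> int \<Rightarrow> real" where
  "orb \<phi> a t i = \<phi> (a * of_int i + t)"

lemma hull_fun_mono: "hull_fun \<phi> \<Longrightarrow> s \<le> t \<Longrightarrow> \<phi> s \<le> \<phi> t"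
  by (simp add: hull_fun_def monoD)

lemma hull_fun_int:
  assumes "hull_fun \<phi>"
  shows "\<phi> (t + of_int m) = \<phi> t + of_int m"
proof (induction m rule: int_induct[where k = 0])
  case (step1 k)
  have "\<phi> ((t + of_int k) + 1) = \<phi> (t + of_int k) + 1"
    using assms unfolding hull_fun_def by blast
  with step1 show ?case by (simp add: ac_simps)
next
  case (step2 k)
  have "\<phi> ((t + of_int (k - 1)) + 1) = \<phi> (t + of_int (k - 1)) + 1"
    using assms unfolding hull_fun_def by blast
  with step2 show ?case by (simp add: ac_simps)
qed simp

lemma orb_per_seqs:
  assumes "hull_fun \<phi>" "p > 0"
  shows "orb \<phi> (of_int q / of_int p) t \<in> per_seqs p q"
proof (rule per_seqsI)
  fix i
  have "of_int q / of_int p * of_int (i + p) + t = (of_int q / of_int p * of_int i + t) + real_of_int q"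
    using assms(2) by (simp add: field_simps)
  then show "orb \<phi> (of_int q / of_int p) t (i + p) = orb \<phi> (of_int q / of_int p) t i + of_int q"
    unfolding orb_def using hull_fun_int[OF assms(1)] by metis
qed

lemma orb_mono: "hull_fun \<phi> \<Longrightarrow> s \<le> t \<Longrightarrow> orb \<phi> a s i \<le> orb \<phi> a t i"
  unfolding orb_def by (rule hull_fun_mono) auto

lemma orb_add_int: "hull_fun \<phi> \<Longrightarrow> orb \<phi> a (t + of_int m) i = orb \<phi> a t i + of_int m"
  unfolding orb_def by (simp add: hull_fun_int flip: add.assoc)

text \<open>Monotonicity and degree one confine each increment between the floor and the ceiling of
  \<open>a\<close>, so the bound does not involve the hull function.\<close>

lemma orb_lip_seqs:
  assumes "hull_fun \<phi>"
  shows "orb \<phi> a t \<in> lip_seqs (\<bar>a\<bar> + 1)"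
  unfolding lip_seqs_def
proof (intro CollectI allI)
  fix i
  let ?s = "a * of_int i + t"
  have e: "orb \<phi> a t (i + 1) = \<phi> (?s + a)" "orb \<phi> a t i = \<phi> ?s"
    by (simp_all add: orb_def algebra_simps)
  have "\<phi> (?s + a) \<le> \<phi> (?s + of_int \<lceil>a\<rceil>)" "\<phi> (?s + of_int \<lfloor>a\<rfloor>) \<le> \<phi> (?s + a)"
    by (intro hull_fun_mono[OF assms]; simp)+
  then have "\<phi> (?s + a) \<le> \<phi> ?s + of_int \<lceil>a\<rceil>" "\<phi> ?s + of_int \<lfloor>a\<rfloor> \<le> \<phi> (?s + a)"
    by (simp_all add: hull_fun_int[OF assms])
  moreover have "of_int \<lceil>a\<rceil> \<le> \<bar>a\<bar> + 1" "- \<bar>a\<bar> - 1 \<le> of_int \<lfloor>a\<rfloor>" by linarith+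
  ultimately show "\<bar>orb \<phi> a t (i + 1) - orb \<phi> a t i\<bar> \<le> \<bar>a\<bar> + 1"
    unfolding e by linarith
qed

lemma sum_period_shift:
  fixes f :: "int \<Rightarrow> real"
  assumes "\<And>i. f (i + p) = f i" "p > 0"
  shows "(\<Sum>i\<in>{0..<p}. f (i + k)) = (\<Sum>i\<in>{0..<p}. f i)"
proof -
  have "(\<Sum>i\<in>{0..<p}. f (i + k)) = (\<Sum>i\<in>{k..<k + p}. f i)"
    by (rule sum.reindex_bij_witness[of _ "\<lambda>j. j - k" "\<lambda>j. j + k"]) auto
  then show ?thesis using sum_period[of f p, OF assms] by simp
qed

text \<open>Discrete form of the fact that a monotone map of degree one moves points, on average
  over the phase, by exactly the phase shift: its deviation from the identity is periodic and
  cancels, and monotonicity fixes the sign.\<close>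

lemma hull_grid_sum:
  assumes h: "hull_fun \<phi>" and G: "G > 0"
  shows "(\<Sum>n\<in>{0..<G}. \<bar>\<phi> (of_int (n + B) / of_int G) - \<phi> (of_int (n + A) / of_int G)\<bar>) = \<bar>of_int (B - A)\<bar>"
proof -
  define g where "g n = \<phi> (of_int n / of_int G) - of_int n / of_int G" for n
  have per: "g (n + G) = g n" for n
  proof -
    have "real_of_int (n + G) / of_int G = of_int n / of_int G + of_int 1"
      using G by (simp add: field_simps)
    then show ?thesis unfolding g_def using hull_fun_int[OF h, of "of_int n / of_int G" 1] by simp
  qed
  have key: "(\<Sum>n\<in>{0..<G}. \<phi> (of_int (n + B) / of_int G) - \<phi> (of_int (n + A) / of_int G)) = of_int (B - A)" for A B
  proof -
    have "\<phi> (of_int (n + B) / of_int G) - \<phi> (of_int (n + A) / of_int G)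
        = g (n + B) - g (n + A) + of_int (B - A) / of_int G" for n
      using G by (simp add: g_def field_simps)
    then have "(\<Sum>n\<in>{0..<G}. \<phi> (of_int (n + B) / of_int G) - \<phi> (of_int (n + A) / of_int G))
        = (\<Sum>n\<in>{0..<G}. g (n + B)) - (\<Sum>n\<in>{0..<G}. g (n + A)) + (\<Sum>n\<in>{0..<G}. of_int (B - A) / of_int G)"
      by (simp only: sum.distrib sum_subtractf)
    also have "\<dots> = of_int (B - A)"
      using sum_period_shift[of g, OF per G] G by simp
    finally show ?thesis .
  qed
  have *: "(\<Sum>n\<in>{0..<G}. \<bar>\<phi> (of_int (n + B) / of_int G) - \<phi> (of_int (n + A) / of_int G)\<bar>) = of_int (B - A)"
    if "A \<le> B" for A B
  proof -
    have "\<phi> (of_int (n + A) / of_int G) \<le> \<phi> (of_int (n + B) / of_int G)" for n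
      by (rule hull_fun_mono[OF h]) (use that G in \<open>auto intro!: divide_right_mono\<close>)
    then show ?thesis using key[of B A] by (simp del: of_int_add of_int_diff)
  qed
  show ?thesis
  proof (cases "A \<le> B")
    case True then show ?thesis using *[of A B] by simp
  next
    case False then show ?thesis using *[of B A] by (simp add: abs_minus_commute)
  qed
qed

text \<open>By Bezout, a phase change by a multiple of \<open>1 / p\<close> is a relabelling of
  sites plus an integer translation. Hence it does not change the periodic action.\<close>

lemma orb_shift:
  assumes h: "hull_fun \<phi>" and p: "p > 0" and cop: "coprime q p"
  obtains k l where "k * q + l * p = m"
    "\<And>i. orb \<phi> (of_int q / of_int p) (t + of_int m / of_int p) i = orb \<phi> (of_int q / of_int p) t (i + k) + of_int l"
proof -
  obtain u v where "u * q + v * p = 1" using bezout_int[of q p] cop by auto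
  then have "(m * u) * q + (m * v) * p = m" by (metis distrib_left mult.assoc mult.right_neutral)
  then obtain k l where kl: "k * q + l * p = m" by blast
  have "orb \<phi> (of_int q / of_int p) (t + of_int m / of_int p) i = orb \<phi> (of_int q / of_int p) t (i + k) + of_int l" for i
  proof -
    have "real_of_int q / of_int p * of_int i + (t + of_int m / of_int p)
        = (of_int q / of_int p * of_int (i + k) + t) + of_int l"
      using p unfolding kl[symmetric] by (simp add: field_simps)
    then show ?thesis unfolding orb_def using hull_fun_int[OF h] by metis
  qed
  with kl that show ?thesis by blast
qed

text \<open>By \<open>orb_shift\<close> the gap is a difference of two translates of the periodic
  deviation \<open>g\<close>, which cancels over a period, plus the constant \<open>m / p\<close>.
  This is what limits the total width of a strip between two orbits.\<close>

lemma orb_gap_sum: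
  assumes h: "hull_fun \<phi>" and p: "p > 0" and cop: "coprime q p"
  shows "(\<Sum>i\<in>{0..<p}. orb \<phi> (of_int q / of_int p) (t + of_int m / of_int p) i
      - orb \<phi> (of_int q / of_int p) t i) = of_int m"
proof -
  let ?a = "real_of_int q / of_int p"
  obtain k l where kl: "k * q + l * p = m"
    and e: "\<And>i. orb \<phi> ?a (t + of_int m / of_int p) i = orb \<phi> ?a t (i + k) + of_int l"
    using orb_shift[OF assms, where m = m] by metis
  define g where "g i = orb \<phi> ?a t i - ?a * of_int i" for i
  have per: "g (i + p) = g i" for i
    using per_seqsD[OF orb_per_seqs[OF h p], of q t i] p by (simp add: g_def field_simps)
  have "real_of_int m / of_int p = ?a * of_int k + of_int l"
    using p unfolding kl[symmetric] by (simp add: field_simps)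
  then have "orb \<phi> ?a (t + of_int m / of_int p) i - orb \<phi> ?a t i = g (i + k) - g i + of_int m / of_int p" for i
    unfolding e g_def by (simp add: distrib_left)
  then have "(\<Sum>i\<in>{0..<p}. orb \<phi> ?a (t + of_int m / of_int p) i - orb \<phi> ?a t i)
      = (\<Sum>i\<in>{0..<p}. g (i + k)) - (\<Sum>i\<in>{0..<p}. g i) + (\<Sum>i\<in>{0..<p}. of_int m / of_int p)"
    by (simp only: sum.distrib sum_subtractf)
  then show ?thesis using sum_period_shift[of g, OF per p] p by simp
qed

section \<open>Ordered families of minimisers and mean actions\<close>

context potential
begin

text \<open>Maximum and minimum both have at least the minimal action, so submodularity forces
  equality for each.\<close>

lemma minimisers_min:
  assumes "p > 0" "x \<in> per_seqs p q" "y \<in> per_seqs p q"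
    "per_action S p x = min_action p q" "per_action S p y = min_action p q"
  shows "per_action S p (\<lambda>i. min (x i) (y i)) = min_action p q"
  using per_action_max_min[of p x y] min_action_le[OF assms(1) per_seqs_max[OF assms(2,3)]]
    min_action_le[OF assms(1) per_seqs_min[OF assms(2,3)]] assms(4,5)
  by linarith

text \<open>Minimise the sum of the entries over one period. The class is closed under pointwise
  minima, so a member dipping below the optimum anywhere would yield a smaller sum.\<close>

lemma least_minimiser:
  fixes q p :: int and t :: real
  defines "C \<equiv> {x \<in> per_seqs p q. per_action S p x = min_action p q \<and>
    (\<forall>i. of_int q / of_int p * of_int i + t \<le> x i)}"
  assumes p: "p > 0"
  shows "\<exists>x\<in>C. \<forall>y\<in>C. \<forall>i. x i \<le> y i"
proof -
  let ?a = "real_of_int q / of_int p"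
  obtain x1 where x1: "x1 \<in> per_seqs p q" "per_action S p x1 = min_action p q"
    using min_action[OF p] by metis
  \<comment> \<open>An integer lift putting \<open>x1\<close> above the line: its deviation from the
    line through the origin is \<open>p\<close>-periodic, hence bounded by the sum over one
    period.\<close>
  define N where "N = \<lceil>(\<Sum>i\<in>{0..<p}. \<bar>x1 i - ?a * of_int i\<bar>) + t\<rceil>"
  define x0 where "x0 i = x1 i + of_int N" for i
  have "x0 \<in> C"
  proof -
    have "?a * of_int i + t \<le> x0 i" for i
    proof -
      let ?r = "i mod p" and ?k = "i div p"
      have "x1 i = x1 ?r + of_int (?k * q)"
        using per_seqs_div_mod[OF x1(1), of i 0] by simp
      moreover have "?a * of_int i = ?a * of_int ?r + of_int (?k * q)"
      proof -
        have "real_of_int i = of_int ?k * of_int p + of_int ?r"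
          by (metis div_mult_mod_eq of_int_add of_int_mult)
        then show ?thesis using p by (simp add: field_simps)
      qed
      moreover have "\<bar>x1 ?r - ?a * of_int ?r\<bar> \<le> (\<Sum>i\<in>{0..<p}. \<bar>x1 i - ?a * of_int i\<bar>)"
        using p by (intro member_le_sum) auto
      moreover have "(\<Sum>i\<in>{0..<p}. \<bar>x1 i - ?a * of_int i\<bar>) + t \<le> of_int N"
        unfolding N_def by linarith
      ultimately show ?thesis unfolding x0_def by linarith
    qed
    moreover have "x0 \<in> per_seqs p q" "per_action S p x0 = min_action p q"
      using per_seqs_shift[OF x1(1), of 0 "of_int N"] per_action_shift[OF x1(1) p, of 0 N] x1(2)
      by (simp_all add: x0_def[abs_def])
    ultimately show ?thesis unfolding C_def by blast
  qed
  \<comment> \<open>The cap \<open>x0\<close> gives compactness and is harmless, since the minimum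
    of a capped sequence with any other stays capped.\<close>
  define K where "K = {x. \<forall>i. ?a * of_int i + t \<le> x i \<and> x i \<le> x0 i} \<inter>
    (per_seqs p q \<inter> {x. per_action S p x = min_action p q})"
  have "compact K" unfolding K_def
    by (intro compact_Int_closed compact_box closed_Int closed_per_seqs closed_Collect_eq
        continuous_per_action continuous_intros)
  moreover have "x0 \<in> K" using \<open>x0 \<in> C\<close> unfolding K_def C_def by auto
  moreover have "continuous_on K (\<lambda>x. \<Sum>i\<in>{0..<p}. x i)"
    by (intro continuous_on_sum continuous_on_subset[OF continuous_on_product_coordinates]) auto
  ultimately obtain x where x: "x \<in> K" and
    xm: "\<And>y. y \<in> K \<Longrightarrow> (\<Sum>i\<in>{0..<p}. x i) \<le> (\<Sum>i\<in>{0..<p}. y i)"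
    using continuous_attains_inf[of K "\<lambda>x. \<Sum>i\<in>{0..<p}. x i"] by blast
  have "x \<in> C" using x unfolding K_def C_def by auto
  moreover have "x i \<le> y i" if y: "y \<in> C" for y i
  proof -
    let ?z = "\<lambda>i. min (x i) (y i)"
    have xy: "x \<in> per_seqs p q" "y \<in> per_seqs p q" using x y unfolding K_def C_def by auto
    have z: "?z \<in> per_seqs p q" by (rule per_seqs_min[OF xy])
    have "?z \<in> K"
      using x y z minimisers_min[OF p xy] unfolding K_def C_def by (auto intro: min.coboundedI1)
    then have le: "(\<Sum>i\<in>{0..<p}. x i) \<le> (\<Sum>i\<in>{0..<p}. ?z i)" by (rule xm)
    have "?z = x"
    proof (rule per_seqs_eqI[OF z xy(1) p], rule ccontr)
      fix j assume j: "0 \<le> j" "j < p" "?z j \<noteq> x j"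
      have "(\<Sum>i\<in>{0..<p}. ?z i) < (\<Sum>i\<in>{0..<p}. x i)"
        by (rule sum_strict_mono_ex1) (use j in \<open>auto intro!: bexI[of _ j]\<close>)
      with le show False by simp
    qed
    from fun_cong[OF this, of i] show ?thesis by simp
  qed
  ultimately show ?thesis by blast
qed

text \<open>Translations of site and value carry the class above one line onto the class above the
  translated line. Least elements are unique, so they are carried along too, and the whole family is
  encoded by the value at site 0.\<close>

lemma minimising_hull:
  assumes p: "p > 0"
  obtains \<phi> where "hull_fun \<phi>" "\<And>t. per_action S p (orb \<phi> (of_int q / of_int p) t) = min_action p q"
proof -
  let ?a = "real_of_int q / of_int p"
  define C where "C t = {x \<in> per_seqs p q. per_action S p x = min_action p q \<and> (\<forall>i. ?a * of_int i + t \<le> x i)}" for t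
  have "\<forall>t. \<exists>x. x \<in> C t \<and> (\<forall>y\<in>C t. \<forall>i. x i \<le> y i)"
    using least_minimiser[OF p, of q] unfolding C_def by blast
  from choice[OF this] obtain X where "\<forall>t. X t \<in> C t \<and> (\<forall>y\<in>C t. \<forall>i. X t i \<le> y i)" ..
  then have X: "\<And>t. X t \<in> C t" and least: "\<And>t y i. y \<in> C t \<Longrightarrow> X t i \<le> y i"
    by blast+
  have shiftC: "(\<lambda>i. x (i + k) + of_int l) \<in> C (t + ?a * of_int k + of_int l)" if "x \<in> C t" for x t k l
  proof -
    have bound: "?a * of_int i + (t + ?a * of_int k + of_int l) \<le> x (i + k) + of_int l" for i
    proof -
      have "?a * of_int (i + k) + t \<le> x (i + k)" using that unfolding C_def by blast
      moreover have "?a * of_int (i + k) = ?a * of_int i + ?a * of_int k"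
        by (simp only: of_int_add distrib_left)
      ultimately show ?thesis by linarith
    qed
    have x: "x \<in> per_seqs p q" "per_action S p x = min_action p q"
      using that unfolding C_def by blast+
    show ?thesis
      unfolding C_def
    proof (intro CollectI conjI allI)
      show "(\<lambda>i. x (i + k) + of_int l) \<in> per_seqs p q" by (rule per_seqs_shift[OF x(1)])
      show "per_action S p (\<lambda>i. x (i + k) + of_int l) = min_action p q"
        unfolding per_action_shift[OF x(1) p] by (rule x(2))
    qed (rule bound)
  qed
  have X_shift: "X (t + ?a * of_int k + of_int l) i = X t (i + k) + of_int l" for t k l i
  proof (rule antisym)
    show "X (t + ?a * of_int k + of_int l) i \<le> X t (i + k) + of_int l"
      by (rule least[OF shiftC[OF X]])
    have "(\<lambda>i. X (t + ?a * of_int k + of_int l) (i + - k) + of_int (- l))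
        \<in> C (t + ?a * of_int k + of_int l + ?a * of_int (- k) + of_int (- l))"
      by (rule shiftC[OF X])
    then have "(\<lambda>i. X (t + ?a * of_int k + of_int l) (i + - k) + of_int (- l)) \<in> C t" by simp
    from least[OF this, of "i + k"] show "X t (i + k) + of_int l \<le> X (t + ?a * of_int k + of_int l) i"
      by simp
  qed
  \<comment> \<open>\<open>X_shift\<close> makes \<open>X t\<close> the orbit of \<open>\<phi>\<close> at \<open>t\<close>, and leastness makes \<open>\<phi>\<close> monotone.\<close>
  define \<phi> where "\<phi> t = X t 0" for t
  have orb: "orb \<phi> ?a t = X t" for t
  proof
    fix i show "orb \<phi> ?a t i = X t i"
      using X_shift[of t i 0 0] by (simp add: orb_def \<phi>_def add.commute)
  qed
  have "hull_fun \<phi>"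
    unfolding hull_fun_def
  proof (intro conjI allI monoI)
    fix s t :: real assume "s \<le> t"
    have "X t \<in> C s"
      using X[of t] \<open>s \<le> t\<close> unfolding C_def by (auto intro: order_trans[rotated])
    then show "\<phi> s \<le> \<phi> t" unfolding \<phi>_def by (rule least)
  next
    fix t show "\<phi> (t + 1) = \<phi> t + 1" using X_shift[of t 0 1 0] by (simp add: \<phi>_def)
  qed
  moreover have "per_action S p (orb \<phi> ?a t) = min_action p q" for t
    using X[of t] unfolding orb C_def by blast
  ultimately show ?thesis by (rule that)
qed

text \<open>Clip a constrained minimiser from below by \<open>lo\<close>, then from above by
  \<open>hi\<close>. Each time the discarded member of the max-min pair has at least the minimal
  action, so a clipping costs at most \<eta>. The value at 0 survives because \<xi> lies between the
  two barriers.\<close>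

lemma squeeze:
  assumes p: "p > 0" and lo: "lo \<in> per_seqs p q" and hi: "hi \<in> per_seqs p q"
    and le: "\<And>i. lo i \<le> hi i" and \<xi>: "lo 0 \<le> \<xi>" "\<xi> \<le> hi 0"
    and \<eta>: "per_action S p lo \<le> min_action p q + \<eta>" "per_action S p hi \<le> min_action p q + \<eta>"
  obtains y where "y \<in> per_seqs p q" "y 0 = \<xi>" "\<And>i. lo i \<le> y i" "\<And>i. y i \<le> hi i"
    "per_action S p y \<le> min_action_at p q \<xi> + 2 * \<eta>"
proof -
  obtain y0 where y0: "y0 \<in> per_seqs p q" "y0 0 = \<xi>" "per_action S p y0 = min_action_at p q \<xi>"
    using min_action_at[OF p] by metis
  define y1 where "y1 i = max (y0 i) (lo i)" for i
  define y where "y i = min (y1 i) (hi i)" for i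
  have y1: "y1 \<in> per_seqs p q" unfolding y1_def by (rule per_seqs_max[OF y0(1) lo])
  have "per_action S p y1 + min_action p q \<le> per_action S p y0 + per_action S p lo"
    using per_action_max_min[of p y0 lo] min_action_le[OF p per_seqs_min[OF y0(1) lo]]
    unfolding y1_def[abs_def] by linarith
  moreover have "per_action S p y + min_action p q \<le> per_action S p y1 + per_action S p hi"
    using per_action_max_min[of p y1 hi] min_action_le[OF p per_seqs_max[OF y1 hi]]
    unfolding y_def[abs_def] by linarith
  ultimately have "per_action S p y \<le> min_action_at p q \<xi> + 2 * \<eta>" using y0(3) \<eta> by linarith
  moreover have "y \<in> per_seqs p q" unfolding y_def by (rule per_seqs_min[OF y1 hi])
  moreover have "y 0 = \<xi>" using y0(2) \<xi> by (simp add: y_def y1_def)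
  moreover have "lo i \<le> y i" "y i \<le> hi i" for i using le[of i] by (simp_all add: y_def y1_def)
  ultimately show ?thesis using that by blast
qed

text \<open>Averages over the grid of mesh \<open>1 / G\<close> replace the integral in Percival's variational principle.\<close>

lemma grid_average:
  fixes p g :: int
  assumes h: "hull_fun \<phi>" and p: "p > 0" and g: "g > 0" and G: "G = p * g"
  shows "of_int p * (\<Sum>n\<in>{0..<G}. S (window (orb \<phi> (of_int q / of_int p) (of_int n / of_int G)) 0))
    = (\<Sum>n\<in>{0..<G}. per_action S p (orb \<phi> (of_int q / of_int p) (of_int n / of_int G)))"
proof -
  let ?a = "real_of_int q / of_int p"
  have Gpos: "G > 0" using p g G by simp
  define f where "f n = S (window (orb \<phi> ?a (of_int n / of_int G)) 0)" for n :: int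
  have per: "f (n + G) = f n" for n
  proof -
    have "real_of_int (n + G) / of_int G = of_int n / of_int G + of_int 1"
      using Gpos by (simp add: field_simps)
    then have "orb \<phi> ?a (of_int (n + G) / of_int G) = (\<lambda>i. orb \<phi> ?a (of_int n / of_int G) i + of_int 1)"
      by (simp only: orb_add_int[OF h] fun_eq_iff) simp
    then show ?thesis unfolding f_def by (simp only: window_of_int)
  qed
  \<comment> \<open>Since \<open>p\<close> divides \<open>G\<close>, advancing the orbit by
    \<open>j\<close> sites is a move by a whole number of grid points; summing over the full grid
    makes every window contribute equally.\<close>
  have shift: "S (window (orb \<phi> ?a (of_int n / of_int G)) j) = f (n + q * g * j)" for n j
  proof -
    have "orb \<phi> ?a (of_int n / of_int G) (i + j) = orb \<phi> ?a (of_int (n + q * g * j) / of_int G) i" for i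
    proof -
      have "?a * of_int (i + j) + of_int n / of_int G = ?a * of_int i + of_int (n + q * g * j) / of_int G"
        using p g unfolding G by (simp add: field_simps)
      then show ?thesis unfolding orb_def by simp
    qed
    then show ?thesis unfolding f_def window_shift[of _ j] by simp
  qed
  have "(\<Sum>n\<in>{0..<G}. per_action S p (orb \<phi> ?a (of_int n / of_int G)))
      = (\<Sum>n\<in>{0..<G}. \<Sum>j\<in>{0..<p}. f (n + q * g * j))"
    unfolding per_action_def shift ..
  also have "\<dots> = (\<Sum>j\<in>{0..<p}. \<Sum>n\<in>{0..<G}. f (n + q * g * j))" by (rule sum.swap)
  also have "\<dots> = of_int p * (\<Sum>n\<in>{0..<G}. f n)"
    using p by (simp add: sum_period_shift[of f, OF per Gpos])
  finally show ?thesis unfolding f_def ..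
qed

text \<open>With \<open>G = p * P\<close> the displacements along both slopes are multiples of the
  mesh, so \<open>hull_grid_sum\<close> evaluates the mean distance of the two orbits at site
  \<open>k\<close> exactly as \<open>k\<close> times the difference of the slopes. The square of
  \<open>CARD('n)\<close> comes from the number of window entries and from the bound on their
  positions.\<close>

lemma grid_lipschitz:
  fixes p q P Q :: int
  defines "a \<equiv> real_of_int q / of_int p" and "b \<equiv> real_of_int Q / of_int P" and "G \<equiv> p * P"
  assumes h: "hull_fun \<phi>" and p: "p > 0" and P: "P > 0"
    and L: "lip_const K L S" "L \<ge> 0" and K: "\<bar>a\<bar> + 1 \<le> K" "\<bar>b\<bar> + 1 \<le> K"
  shows "\<bar>(\<Sum>n\<in>{0..<G}. S (window (orb \<phi> a (of_int n / of_int G)) 0)) -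
      (\<Sum>n\<in>{0..<G}. S (window (orb \<phi> b (of_int n / of_int G)) 0))\<bar>
    \<le> L * (real CARD('n))\<^sup>2 * of_int G * \<bar>a - b\<bar>"
proof -
  have Gpos: "G > 0" using p P G_def by simp
  have lip: "orb \<phi> a t \<in> lip_seqs K" "orb \<phi> b t \<in> lip_seqs K" for t
    using orb_lip_seqs[OF h, of a t] orb_lip_seqs[OF h, of b t] K
    unfolding lip_seqs_def by (auto intro: order_trans)
  have k: "(\<Sum>n\<in>{0..<G}. \<bar>orb \<phi> a (of_int n / of_int G) (int k) - orb \<phi> b (of_int n / of_int G) (int k)\<bar>)
      = real k * (of_int G * \<bar>a - b\<bar>)" for k :: nat
  proof -
    have e: "orb \<phi> a (of_int n / of_int G) (int k) = \<phi> (of_int (n + q * P * int k) / of_int G)"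
      "orb \<phi> b (of_int n / of_int G) (int k) = \<phi> (of_int (n + Q * p * int k) / of_int G)" for n
      using p P unfolding orb_def a_def b_def G_def by (auto intro!: arg_cong[of _ _ \<phi>] simp: field_simps)
    have "real_of_int (q * P * int k - Q * p * int k) = real k * (of_int G * (a - b))"
      using p P unfolding a_def b_def G_def by (simp add: field_simps)
    then show ?thesis unfolding e hull_grid_sum[OF h Gpos]
      using Gpos by (simp add: abs_mult)
  qed
  have "\<bar>(\<Sum>n\<in>{0..<G}. S (window (orb \<phi> a (of_int n / of_int G)) 0)) -
      (\<Sum>n\<in>{0..<G}. S (window (orb \<phi> b (of_int n / of_int G)) 0))\<bar>
    \<le> (\<Sum>n\<in>{0..<G}. \<bar>S (window (orb \<phi> a (of_int n / of_int G)) 0) - S (window (orb \<phi> b (of_int n / of_int G)) 0)\<bar>)"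
    unfolding sum_subtractf[symmetric] by (rule sum_abs)
  also have "\<dots> \<le> (\<Sum>n\<in>{0..<G}. L * (\<Sum>i::'n\<in>UNIV.
      \<bar>orb \<phi> a (of_int n / of_int G) (0 + int (pos i)) - orb \<phi> b (of_int n / of_int G) (0 + int (pos i))\<bar>))"
    by (intro sum_mono lip_constD[OF L(1)] lip)
  also have "\<dots> = L * (\<Sum>i::'n\<in>UNIV. real (pos i) * (of_int G * \<bar>a - b\<bar>))"
    unfolding sum_distrib_left[symmetric] by (subst sum.swap) (simp only: add_0 k)
  also have "\<dots> \<le> L * (\<Sum>i::'n\<in>UNIV. real CARD('n) * (of_int G * \<bar>a - b\<bar>))"
    using pos_less_card Gpos L(2)
    by (intro mult_left_mono sum_mono mult_right_mono) (auto intro: less_imp_le)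
  also have "\<dots> = L * (real CARD('n))\<^sup>2 * of_int G * \<bar>a - b\<bar>"
    by (simp add: power2_eq_square)
  finally show ?thesis .
qed

text \<open>Orbits of \<phi> along \<open>b\<close> are competitors, so \<psi> has the smaller mean
  action at slope \<open>b\<close>. Passing from \<open>b\<close> to \<open>a\<close> is paid once
  for \<psi> and once for \<phi>, whence the factor 2.\<close>

lemma almost_minimal_orbit:
  fixes p q P Q :: int
  defines "a \<equiv> real_of_int q / of_int p" and "b \<equiv> real_of_int Q / of_int P"
  assumes \<psi>: "hull_fun \<psi>" "\<And>t. per_action S P (orb \<psi> b t) = min_action P Q"
    and p: "p > 0" and P: "P > 0"
    and L: "lip_const K L S" "L \<ge> 0" and K: "\<bar>a\<bar> + 1 \<le> K" "\<bar>b\<bar> + 1 \<le> K"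
  obtains \<theta> where "per_action S p (orb \<psi> a \<theta>)
    \<le> min_action p q + 2 * (L * (real CARD('n))\<^sup>2 * of_int p * \<bar>a - b\<bar>)"
proof -
  define G where "G = p * P"
  have Gpos: "G > 0" using p P G_def by simp
  obtain \<phi> where \<phi>: "hull_fun \<phi>" "\<And>t. per_action S p (orb \<phi> a t) = min_action p q"
    using minimising_hull[OF p, of q] unfolding a_def by metis
  define E where "E f c = (\<Sum>n\<in>{0..<G}. S (window (orb f c (of_int n / of_int G)) 0))" for f c
  define D where "D = L * (real CARD('n))\<^sup>2 * \<bar>a - b\<bar>"
  have G': "G = P * p" by (simp add: G_def)
  have Ea: "of_int p * E f a = (\<Sum>n\<in>{0..<G}. per_action S p (orb f a (of_int n / of_int G)))"
    if "hull_fun f" for f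
    using grid_average[OF that p P G_def, of q] unfolding E_def a_def .
  have Eb: "of_int P * E f b = (\<Sum>n\<in>{0..<G}. per_action S P (orb f b (of_int n / of_int G)))"
    if "hull_fun f" for f
    using grid_average[OF that P p G', of Q] unfolding E_def b_def .
  have E1: "\<bar>E f a - E f b\<bar> \<le> of_int G * D" if "hull_fun f" for f
    using grid_lipschitz[OF that p P L, of q Q] K unfolding E_def D_def G_def a_def b_def
    by (simp add: ac_simps)
  have "of_int G * min_action P Q \<le> of_int P * E \<phi> b"
  proof -
    have "(\<Sum>n\<in>{0..<G}. min_action P Q) \<le> (\<Sum>n\<in>{0..<G}. per_action S P (orb \<phi> b (of_int n / of_int G)))"
      unfolding b_def by (intro sum_mono min_action_le[OF P] orb_per_seqs[OF \<phi>(1) P])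
    then show ?thesis unfolding Eb[OF \<phi>(1)] using Gpos by simp
  qed
  moreover have "of_int P * E \<psi> b = of_int G * min_action P Q"
    unfolding Eb[OF \<psi>(1)] \<psi>(2) using Gpos by simp
  ultimately have "of_int P * E \<psi> b \<le> of_int P * E \<phi> b" by simp
  then have "E \<psi> b \<le> E \<phi> b" using P by simp
  then have "E \<psi> a \<le> E \<phi> a + 2 * (of_int G * D)"
    using E1[OF \<psi>(1)] E1[OF \<phi>(1)] by linarith
  then have "of_int p * E \<psi> a \<le> of_int p * E \<phi> a + 2 * (of_int p * of_int G * D)"
    using p mult_left_mono[of "E \<psi> a" "E \<phi> a + 2 * (of_int G * D)" "of_int p"]
    by (simp add: algebra_simps)
  moreover have "of_int p * E \<phi> a = of_int G * min_action p q"
    unfolding Ea[OF \<phi>(1)] \<phi>(2) using Gpos by simp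
  ultimately have le: "of_int p * E \<psi> a \<le> of_int G * (min_action p q + 2 * (of_int p * D))"
    by (simp add: algebra_simps)
  \<comment> \<open>The estimate so far concerns the average over grid phases; some phase does no
    worse than the average.\<close>
  have "\<exists>n. per_action S p (orb \<psi> a (of_int n / of_int G)) \<le> min_action p q + 2 * (of_int p * D)"
  proof (rule ccontr)
    assume "\<not> ?thesis"
    then have "(\<Sum>n\<in>{0..<G}. min_action p q + 2 * (of_int p * D))
        < (\<Sum>n\<in>{0..<G}. per_action S p (orb \<psi> a (of_int n / of_int G)))"
      using Gpos by (intro sum_strict_mono) (auto simp: not_le)
    then show False using le Gpos unfolding Ea[OF \<psi>(1)] by simp
  qed
  then show ?thesis using that unfolding D_def by (auto simp: ac_simps)
qed

end

section \<open>Exchanging blocks\<close>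


lemma energy_split: "s \<le> m \<Longrightarrow> m \<le> e \<Longrightarrow> energy S x s e = energy S x s m + energy S x m e"
  unfolding energy_def by (subst sum.union_disjoint[symmetric]) (auto simp: ivl_disj_un)

text \<open>Windows starting in the range differ only through their overhang beyond
  \<open>e\<close>. For a fixed position in the window each overhanging site is met at most once,
  and there are \<open>CARD('n)\<close> positions.\<close>

lemma energy_diff_le:
  fixes S :: "real ^ 'n::{finite,linorder} \<Rightarrow> real"
  assumes L: "lip_const K L S" "L \<ge> 0" and uv: "u \<in> lip_seqs K" "v \<in> lip_seqs K"
    and eq: "\<And>i. s \<le> i \<Longrightarrow> i < e \<Longrightarrow> u i = v i"
  shows "\<bar>energy S u s e - energy S v s e\<bar>
    \<le> L * real CARD('n) * (\<Sum>i\<in>{e..<e + int CARD('n)}. \<bar>u i - v i\<bar>)"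
proof -
  let ?d = "\<lambda>i. \<bar>u i - v i\<bar>" and ?B = "\<Sum>i\<in>{e..<e + int CARD('n)}. \<bar>u i - v i\<bar>"
  have shift: "(\<Sum>j\<in>{s..<e}. ?d (j + int (pos k))) \<le> ?B" for k :: 'n
  proof -
    let ?m = "int (pos k)"
    have "(\<Sum>j\<in>{s..<e}. ?d (j + ?m)) = (\<Sum>i\<in>{s + ?m..<e + ?m}. ?d i)"
      by (rule sum.reindex_bij_witness[of _ "\<lambda>j. j - ?m" "\<lambda>j. j + ?m"]) auto
    also have "\<dots> = (\<Sum>i\<in>{s + ?m..<e + ?m} \<inter> {e..}. ?d i)"
    proof (rule sum.mono_neutral_right)
      show "\<forall>i\<in>{s + ?m..<e + ?m} - {s + ?m..<e + ?m} \<inter> {e..}. ?d i = 0"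
      proof
        fix i assume "i \<in> {s + ?m..<e + ?m} - {s + ?m..<e + ?m} \<inter> {e..}"
        then have "s \<le> i" "i < e" by auto
        then show "?d i = 0" using eq by simp
      qed
    qed auto
    also have "\<dots> \<le> ?B"
      by (rule sum_mono2) (use pos_less_card[of k] in auto)
    finally show ?thesis .
  qed
  have "\<bar>energy S u s e - energy S v s e\<bar> \<le> (\<Sum>j\<in>{s..<e}. \<bar>S (window u j) - S (window v j)\<bar>)"
    unfolding energy_def sum_subtractf[symmetric] by (rule sum_abs)
  also have "\<dots> \<le> (\<Sum>j\<in>{s..<e}. L * (\<Sum>k::'n\<in>UNIV. ?d (j + int (pos k))))"
    by (intro sum_mono lip_constD[OF L(1)] uv)
  also have "\<dots> = L * (\<Sum>k::'n\<in>UNIV. \<Sum>j\<in>{s..<e}. ?d (j + int (pos k)))"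
    unfolding sum_distrib_left[symmetric] by (subst sum.swap) (rule refl)
  also have "\<dots> \<le> L * (\<Sum>k::'n\<in>UNIV. ?B)"
    by (intro mult_left_mono sum_mono shift L)
  finally show ?thesis by (simp add: mult.assoc)
qed

definition per_ext :: "int \<Rightarrow> int \<Rightarrow> int \<Rightarrow> (int \<Rightarrow> real) \<Rightarrow> int \<Rightarrow> real" where
  "per_ext p q s w i = w (s + (i - s) mod p) + of_int ((i - s) div p * q)"

lemma per_ext_per_seqs:
  assumes "p > 0"
  shows "per_ext p q s w \<in> per_seqs p q"
proof (rule per_seqsI)
  fix i
  have "i + p - s = i - s + p" by simp
  then have "(i + p - s) mod p = (i - s) mod p" "(i + p - s) div p = (i - s) div p + 1"
    using assms by (simp_all only: mod_add_self2 div_add_self2)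
  then show "per_ext p q s w (i + p) = per_ext p q s w i + of_int q"
    unfolding per_ext_def by (simp add: distrib_right)
qed

lemma per_ext_eq: "s \<le> i \<Longrightarrow> i < s + p \<Longrightarrow> per_ext p q s w i = w i"
  by (simp add: per_ext_def)

lemma lip_seqs_near:
  assumes u: "u \<in> lip_seqs K" and K: "K + 2 \<le> K'" and d: "\<And>i. \<bar>z i - u i\<bar> \<le> 1"
  shows "z \<in> lip_seqs K'"
  unfolding lip_seqs_def
proof (intro CollectI allI)
  fix i
  have "\<bar>u (i + 1) - u i\<bar> \<le> K" using u by (simp add: lip_seqs_def)
  then show "\<bar>z (i + 1) - z i\<bar> \<le> K'" using d[of i] d[of "i + 1"] K by linarith
qed

lemma lip_seqs_near_per:
  assumes u: "u \<in> lip_seqs K" and K: "K + 2 \<le> K'" and p: "p > 0"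
    and per: "u \<in> per_seqs p q" "z \<in> per_seqs p q"
    and d: "\<And>i. s \<le> i \<Longrightarrow> i < s + p \<Longrightarrow> \<bar>z i - u i\<bar> \<le> 1"
  shows "z \<in> lip_seqs K'"
proof (rule lip_seqs_near[OF u K])
  fix i
  have "\<bar>z (s + (i - s) mod p) - u (s + (i - s) mod p)\<bar> \<le> 1" using p by (intro d) auto
  then show "\<bar>z i - u i\<bar> \<le> 1"
    using per_seqs_div_mod[OF per(1), of i s] per_seqs_div_mod[OF per(2), of i s] by simp
qed

text \<open>Summed over all \<open>p\<close> starting points, the block sums count each residue
  \<open>r\<close> times, so some block is at most the average. The range of starting points ensures
  that the period beginning at \<open>s\<close> contains site 0.\<close>

lemma sparse_block:
  fixes D :: "int \<Rightarrow> real" and r :: nat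
  assumes p: "p > 0" and per: "\<And>i. D (i + p) = D i" and c: "(\<Sum>i\<in>{0..<p}. D i) \<le> c"
  obtains s where "- p < s" "s \<le> 0" "(\<Sum>i\<in>{s..<s + int r}. D i) \<le> c * real r / of_int p"
proof -
  have "\<exists>s\<in>{1 - p..<1 - p + p}. (\<Sum>i\<in>{s..<s + int r}. D i) \<le> c * real r / of_int p"
  proof (rule ccontr)
    assume "\<not> ?thesis"
    then have "(\<Sum>s\<in>{1 - p..<1 - p + p}. c * real r / of_int p)
        < (\<Sum>s\<in>{1 - p..<1 - p + p}. \<Sum>i\<in>{s..<s + int r}. D i)"
      using p by (intro sum_strict_mono) (auto simp: not_le)
    also have "\<dots> = (\<Sum>s\<in>{1 - p..<1 - p + p}. \<Sum>k\<in>{0..<int r}. D (s + k))"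
    proof (rule sum.cong[OF refl])
      fix s
      show "(\<Sum>i\<in>{s..<s + int r}. D i) = (\<Sum>k\<in>{0..<int r}. D (s + k))"
        by (rule sum.reindex_bij_witness[of _ "\<lambda>k. s + k" "\<lambda>i. i - s"]) auto
    qed
    also have "\<dots> = (\<Sum>k\<in>{0..<int r}. \<Sum>s\<in>{1 - p..<1 - p + p}. D (s + k))"
      by (rule sum.swap)
    also have "\<dots> = (\<Sum>k\<in>{0..<int r}. \<Sum>i\<in>{0..<p}. D i)"
    proof (rule sum.cong[OF refl])
      fix k
      have "(\<Sum>s\<in>{1 - p..<1 - p + p}. D (s + k)) = (\<Sum>i\<in>{1 - p + k..<1 - p + k + p}. D i)"
        by (rule sum.reindex_bij_witness[of _ "\<lambda>j. j - k" "\<lambda>j. j + k"]) auto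
      also have "\<dots> = (\<Sum>i\<in>{0..<p}. D i)" by (rule sum_period[of D, OF per p])
      finally show "(\<Sum>s\<in>{1 - p..<1 - p + p}. D (s + k)) = (\<Sum>i\<in>{0..<p}. D i)" .
    qed
    also have "\<dots> \<le> real r * c" using c by (simp add: mult_left_mono)
    finally show False using p by simp
  qed
  then obtain s where "s \<in> {1 - p..<1 - p + p}" "(\<Sum>i\<in>{s..<s + int r}. D i) \<le> c * real r / of_int p"
    by blast
  then show ?thesis using that[of s] by simp
qed

context potential
begin

text \<open>The blocks of length \<open>p\<close> around \<open>0\<close> of \<open>u\<close> and \<open>v\<close> are exchanged. The cut \<open>s\<close> is placed where
  \<open>u\<close> and \<open>v\<close> are close on a whole range of interaction; by periodicity they are then close at the other
  end of the block too, so that only the windows straddling a cut contribute to the error.\<close>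

lemma swap_blocks:
  fixes p q P Q :: int
  defines "r \<equiv> CARD('n)"
  assumes p: "int r \<le> p" "p > 0" and P: "p + int r \<le> P"
    and u: "u \<in> per_seqs P Q" "u \<in> lip_seqs K0" and v: "v \<in> per_seqs p q" "v \<in> lip_seqs K0"
    and K: "K0 + 2 \<le> K" and L: "lip_const K L S" "L \<ge> 0"
    and D: "\<And>i. - p < i \<Longrightarrow> i < 2 * p \<Longrightarrow> \<bar>u i - v i\<bar> \<le> D i"
    and D_per: "\<And>i. D (i + p) = D i" and D1: "\<And>i. D i \<le> 1" and D_sum: "(\<Sum>i\<in>{0..<p}. D i) \<le> 5"
  obtains u' v' where "u' \<in> per_seqs P Q" "v' \<in> per_seqs p q" "u' 0 = v 0" "v' 0 = u 0"
    "per_action S P u' + per_action S p v'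
      \<le> per_action S P u + per_action S p v + 20 * L * (real r)\<^sup>2 / of_int p"
proof -
  obtain s where s: "- p < s" "s \<le> 0" and B: "(\<Sum>i\<in>{s..<s + int r}. D i) \<le> 5 * real r / of_int p"
    using sparse_block[of p D 5 r, OF p(2) D_per D_sum] by blast
  define B where "B = 5 * real r / of_int p"
  have P0: "P > 0" using P p by linarith
  \<comment> \<open>\<open>u'\<close> follows \<open>v\<close> on one block of length
    \<open>p\<close> and \<open>u\<close> on the rest of its period; \<open>v'\<close> repeats the
    block removed from \<open>u\<close>. As site 0 lies in the block, the values at 0 are
    exchanged.\<close>
  define u' where "u' = per_ext P Q s (\<lambda>i. if i < s + p then v i else u i)"
  define v' where "v' = per_ext p q s u"
  have u'_per: "u' \<in> per_seqs P Q" unfolding u'_def by (rule per_ext_per_seqs[OF P0])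
  have v'_per: "v' \<in> per_seqs p q" unfolding v'_def by (rule per_ext_per_seqs[OF p(2)])
  have u'_eq: "u' i = v i" if "s \<le> i" "i < s + p" for i
    using that P unfolding u'_def by (subst per_ext_eq) auto
  have u'_eq': "u' i = u i" if "s + p \<le> i" "i < s + P" for i
    using that P p unfolding u'_def by (subst per_ext_eq) auto
  have v'_eq: "v' i = u i" if "s \<le> i" "i < s + p" for i
    using that unfolding v'_def by (rule per_ext_eq)
  have lip_mono: "u \<in> lip_seqs K" "v \<in> lip_seqs K"
    using u(2) v(2) K unfolding lip_seqs_def by (auto intro: order_trans)
  have near: "\<bar>u i - v i\<bar> \<le> 1" if "s \<le> i" "i < s + p" for i
    using D[of i] D1[of i] that s p by linarith
  have u'_lip: "u' \<in> lip_seqs K"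
  proof (rule lip_seqs_near_per[OF u(2) K P0 u(1) u'_per, of s])
    fix i assume i: "s \<le> i" "i < s + P"
    show "\<bar>u' i - u i\<bar> \<le> 1"
      using near[of i] u'_eq[of i] u'_eq'[of i] i by (cases "i < s + p") (auto simp: abs_minus_commute)
  qed
  have v'_lip: "v' \<in> lip_seqs K"
    by (rule lip_seqs_near_per[OF v(2) K p(2) v(1) v'_per, of s]) (use near v'_eq in simp)
  have Dp: "D (i - p) = D i" for i using D_per[of "i - p"] by simp
  have sumD: "(\<Sum>i\<in>{s + p..<s + p + int r}. D i) \<le> B"
  proof -
    have "(\<Sum>i\<in>{s + p..<s + p + int r}. D i) = (\<Sum>i\<in>{s..<s + int r}. D i)"
      by (rule sum.reindex_bij_witness[of _ "\<lambda>i. i + p" "\<lambda>i. i - p"]) (auto simp: Dp)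
    then show ?thesis using B unfolding B_def by simp
  qed
  have e1: "\<bar>energy S u' s (s + p) - energy S v s (s + p)\<bar> \<le> L * real r * B"
  proof -
    have "(\<Sum>i\<in>{s + p..<s + p + int r}. \<bar>u' i - v i\<bar>) \<le> (\<Sum>i\<in>{s + p..<s + p + int r}. D i)"
      by (rule sum_mono) (use u'_eq' D s p P in auto)
    then have "(\<Sum>i\<in>{s + p..<s + p + int r}. \<bar>u' i - v i\<bar>) \<le> B" using sumD by simp
    then show ?thesis
      using energy_diff_le[OF L u'_lip lip_mono(2), of s "s + p"] u'_eq L(2)
      unfolding r_def by (smt (verit) mult_left_mono mult_nonneg_nonneg of_nat_0_le_iff)
  qed
  have e2: "\<bar>energy S u' (s + p) (s + P) - energy S u (s + p) (s + P)\<bar> \<le> L * real r * B"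
  proof -
    \<comment> \<open>The overhang past \<open>s + P\<close> is moved back by the period
      \<open>P\<close> to the start of the block, where \<open>u'\<close> equals
      \<open>v\<close>.\<close>
    have "(\<Sum>i\<in>{s + P..<s + P + int r}. \<bar>u' i - u i\<bar>) = (\<Sum>i\<in>{s..<s + int r}. \<bar>u' i - u i\<bar>)"
    proof (rule sum.reindex_bij_witness[of _ "\<lambda>i. i + P" "\<lambda>i. i - P"])
      fix i
      show "\<bar>u' (i - P) - u (i - P)\<bar> = \<bar>u' i - u i\<bar>"
        using per_seqsD[OF u'_per, of "i - P"] per_seqsD[OF u(1), of "i - P"] by simp
    qed auto
    also have "\<dots> \<le> (\<Sum>i\<in>{s..<s + int r}. D i)"
      by (rule sum_mono) (use u'_eq D s p in \<open>auto simp: abs_minus_commute\<close>)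
    finally have "(\<Sum>i\<in>{s + P..<s + P + int r}. \<bar>u' i - u i\<bar>) \<le> B" using B unfolding B_def by simp
    then show ?thesis
      using energy_diff_le[OF L u'_lip lip_mono(1), of "s + p" "s + P"] u'_eq' L(2)
      unfolding r_def by (smt (verit) mult_left_mono mult_nonneg_nonneg of_nat_0_le_iff)
  qed
  have e3: "\<bar>energy S v' s (s + p) - energy S u s (s + p)\<bar> \<le> L * real r * (2 * B)"
  proof -
    have "(\<Sum>i\<in>{s + p..<s + p + int r}. \<bar>v' i - u i\<bar>) \<le> (\<Sum>i\<in>{s + p..<s + p + int r}. 2 * D i)"
    proof (rule sum_mono)
      \<comment> \<open>Past the cut \<open>v'\<close> is a translated copy of \<open>u\<close> from
        one period \<open>p\<close> earlier. Comparison with \<open>u\<close> goes through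
        \<open>v\<close> and uses \<open>D\<close> at both places, which doubles the bound; the
        three estimates add up to four units.\<close>
      fix i assume i: "i \<in> {s + p..<s + p + int r}"
      have "v' i = u (i - p) + of_int q" "v i = v (i - p) + of_int q"
        using per_seqsD[OF v'_per, of "i - p"] v'_eq[of "i - p"] per_seqsD[OF v(1), of "i - p"] i p
        by auto
      then have "\<bar>v' i - u i\<bar> \<le> \<bar>u (i - p) - v (i - p)\<bar> + \<bar>u i - v i\<bar>" by simp
      also have "\<dots> \<le> D (i - p) + D i" by (intro add_mono D) (use i s p in auto)
      finally show "\<bar>v' i - u i\<bar> \<le> 2 * D i" by (simp add: Dp)
    qed
    then have "(\<Sum>i\<in>{s + p..<s + p + int r}. \<bar>v' i - u i\<bar>) \<le> 2 * B"
      using sumD by (simp flip: sum_distrib_left)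
    then show ?thesis
      using energy_diff_le[OF L v'_lip lip_mono(1), of s "s + p"] v'_eq L(2)
      unfolding r_def by (smt (verit) mult_left_mono mult_nonneg_nonneg of_nat_0_le_iff)
  qed
  have split: "energy S x s (s + P) = energy S x s (s + p) + energy S x (s + p) (s + P)" for x
    using P p by (intro energy_split) auto
  have "per_action S P u' + per_action S p v'
      \<le> per_action S P u + per_action S p v + 4 * (L * real r * B)"
    using e1 e2 e3 unfolding energy_period[OF u'_per P0, of s, symmetric] energy_period[OF u(1) P0, of s, symmetric]
      energy_period[OF v'_per p(2), of s, symmetric] energy_period[OF v(1) p(2), of s, symmetric] split
    by linarith
  also have "4 * (L * real r * B) = 20 * L * (real r)\<^sup>2 / of_int p"
    by (simp add: B_def power2_eq_square)
  finally show ?thesis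
    using that[OF u'_per v'_per] u'_eq[of 0] v'_eq[of 0] s by auto
qed

text \<open>The constant 24 is 20 from the exchange of blocks plus twice the defect \<eta>, which is
  at most 2 in the same unit \<open>X\<close>.\<close>

lemma barrier_comparison:
  fixes p q P Q :: int
  defines "a \<equiv> real_of_int q / of_int p" and "b \<equiv> real_of_int Q / of_int P" and "r \<equiv> CARD('n)"
  assumes cop: "coprime q p" and p: "5 \<le> p" "int r \<le> p" and P: "p + int r \<le> P"
    and ab: "\<bar>a - b\<bar> \<le> 1 / (of_int p)\<^sup>2"
    and K: "\<bar>a\<bar> + 5 \<le> K" "\<bar>b\<bar> + 5 \<le> K" and L: "lip_const K L S" "L \<ge> 0"
  shows "\<bar>(min_action_at p q \<xi> - min_action p q) - (min_action_at P Q \<xi> - min_action P Q)\<bar>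
    \<le> 24 * L * (real r)\<^sup>2 / of_int p"
proof -
  have p0: "p > 0" and P0: "P > 0" using p P by linarith+
  define err where "err = 20 * L * (real r)\<^sup>2 / of_int p"
  define \<eta> where "\<eta> = 2 * (L * (real r)\<^sup>2 * of_int p * \<bar>a - b\<bar>)"
  have "of_int p * \<bar>a - b\<bar> \<le> 1 / of_int p"
    using ab p0 by (simp add: field_simps power2_eq_square)
  define X where "X = L * (real r)\<^sup>2 * (1 / of_int p)"
  have "L * (real r)\<^sup>2 * (of_int p * \<bar>a - b\<bar>) \<le> X"
    unfolding X_def using L(2) \<open>of_int p * \<bar>a - b\<bar> \<le> 1 / of_int p\<close> by (intro mult_left_mono) auto
  then have "\<eta> \<le> 2 * X" unfolding \<eta>_def by (simp add: mult.assoc)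
  moreover have "err = 20 * X" "24 * L * (real r)\<^sup>2 / of_int p = 24 * X"
    by (simp_all add: err_def X_def)
  ultimately have \<eta>_le: "2 * \<eta> + err \<le> 24 * L * (real r)\<^sup>2 / of_int p"
    by linarith
  have \<eta>0: "\<eta> \<ge> 0" unfolding \<eta>_def using L(2) p0 by simp
  obtain \<psi> where \<psi>: "hull_fun \<psi>" "\<And>t. per_action S P (orb \<psi> b t) = min_action P Q"
    using minimising_hull[OF P0, of Q] unfolding b_def by metis
  obtain \<theta> where \<theta>: "per_action S p (orb \<psi> a \<theta>) \<le> min_action p q + \<eta>"
    using almost_minimal_orbit[OF \<psi>(1) \<psi>(2)[unfolded b_def] p0 P0 L, of q] K
    unfolding a_def b_def \<eta>_def r_def by auto
  have U_per: "orb \<psi> a t \<in> per_seqs p q" and x_per: "orb \<psi> b t \<in> per_seqs P Q" for t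
    unfolding a_def b_def using orb_per_seqs[OF \<psi>(1)] p0 P0 by auto
  have U_act: "per_action S p (orb \<psi> a (\<theta> + of_int m / of_int p)) \<le> min_action p q + \<eta>" for m
  proof -
    obtain k l where "\<And>i. orb \<psi> a (\<theta> + of_int m / of_int p) i = orb \<psi> a \<theta> (i + k) + of_int l"
      using orb_shift[OF \<psi>(1) p0 cop, of m \<theta>] unfolding a_def by metis
    then have "orb \<psi> a (\<theta> + of_int m / of_int p) = (\<lambda>i. orb \<psi> a \<theta> (i + k) + of_int l)" by auto
    then show ?thesis using \<theta> per_action_shift[OF U_per p0, of \<theta> k l] by simp
  qed
  \<comment> \<open>\<psi> may jump over \<xi>, so \<xi> is only bracketed between consecutive
    phases of mesh \<open>1 / p\<close>. All these phases give the same action at slope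
    \<open>a\<close>; \<open>n\<close> precedes the first phase whose value exceeds \<xi>.\<close>
  obtain n where n: "\<psi> (\<theta> + of_int n / of_int p) \<le> \<xi>" "\<xi> < \<psi> (\<theta> + of_int (n + 1) / of_int p)"
  proof -
    let ?m = "\<lceil>\<xi> - \<psi> \<theta>\<rceil> + 1"
    have "\<psi> (\<theta> + of_int (p * ?m) / of_int p) = \<psi> \<theta> + of_int ?m"
      using p0 hull_fun_int[OF \<psi>(1), of \<theta> ?m] by simp
    then have "\<xi> < \<psi> (\<theta> + of_int (p * ?m) / of_int p)" by linarith
    then obtain m where m: "\<xi> < \<psi> (\<theta> + of_int m / of_int p)" by blast
    let ?k = "\<lfloor>\<xi> - \<psi> \<theta>\<rfloor>"
    have k: "\<psi> (\<theta> + of_int (p * ?k) / of_int p) \<le> \<xi>"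
    proof -
      have "\<psi> (\<theta> + of_int (p * ?k) / of_int p) = \<psi> \<theta> + of_int ?k"
        using p0 hull_fun_int[OF \<psi>(1), of \<theta> ?k] by simp
      then show ?thesis by linarith
    qed
    have up: "\<psi> (\<theta> + of_int i / of_int p) \<le> \<psi> (\<theta> + of_int j / of_int p)" if "i \<le> j" for i j
      using that p0 by (intro hull_fun_mono[OF \<psi>(1)]) (auto intro: divide_right_mono)
    have km: "p * ?k \<le> m" using k m up[of m "p * ?k"] by linarith
    let ?Q = "\<lambda>j. \<xi> < \<psi> (\<theta> + of_int (p * ?k + int j) / of_int p)"
    have "?Q (nat (m - p * ?k))" using m km by simp
    then have l: "?Q (LEAST j. ?Q j)" by (rule LeastI)
    moreover have "(LEAST j. ?Q j) \<noteq> 0"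
    proof
      assume "(LEAST j. ?Q j) = 0"
      with l have "?Q 0" by metis
      then show False using k by simp
    qed
    then obtain j where j: "(LEAST j. ?Q j) = Suc j" using not0_implies_Suc by blast
    then have "\<not> ?Q j" by (metis lessI not_less_Least)
    moreover have "?Q (Suc j)" using l j by metis
    ultimately show ?thesis using that[of "p * ?k + int j"] by (simp add: not_less ac_simps)
  qed
  define c where "c = \<theta> + of_int n / of_int p"
  define c' where "c' = c + 1 / of_int p"
  have c'_eq: "c' = \<theta> + of_int (n + 1) / of_int p"
    unfolding c'_def c_def by (simp add: add_divide_distrib)
  have cc': "c \<le> c'" unfolding c'_def using p0 by simp
  have \<xi>: "\<psi> c \<le> \<xi>" "\<xi> \<le> \<psi> c'" using n unfolding c'_eq c_def by auto
  have orb_\<xi>: "orb \<psi> d c 0 \<le> \<xi>" "\<xi> \<le> orb \<psi> d c' 0" for d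
    using \<xi> by (simp_all add: orb_def)
  \<comment> \<open>For sites of modulus below \<open>2 * p\<close> the slopes \<open>a\<close> and
    \<open>b\<close> separate phases by at most \<open>2 / p\<close>. Adding this slack on both
    sides of the bracket of width \<open>1 / p\<close> gives \<open>5 / p\<close>, hence total gap 5
    over a period.\<close>
  define lo hi where "lo = orb \<psi> a (c - 2 / of_int p)" and "hi = orb \<psi> a (c - 2 / of_int p + of_int 5 / of_int p)"
  define D where "D i = hi i - lo i" for i
  have D_per: "D (i + p) = D i" for i
    using per_seqsD[OF U_per] unfolding D_def lo_def hi_def by simp
  have D_sum: "(\<Sum>i\<in>{0..<p}. D i) \<le> 5"
    using orb_gap_sum[OF \<psi>(1) p0 cop, of "c - 2 / of_int p" 5] unfolding D_def lo_def hi_def a_def by simp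
  have gap1: "orb \<psi> d t' i \<le> orb \<psi> d t i + 1" if "t' \<le> t + 1" for d t t' i
  proof -
    have "orb \<psi> d t' i \<le> orb \<psi> d (t + of_int 1) i" using that by (intro orb_mono[OF \<psi>(1)]) simp
    then show ?thesis using orb_add_int[OF \<psi>(1), of d t 1 i] by simp
  qed
  have "real_of_int 5 / of_int p \<le> 1" using p by simp
  then have D1: "D i \<le> 1" for i
    using gap1[of "c - 2 / of_int p + of_int 5 / of_int p" "c - 2 / of_int p" a i]
    unfolding D_def lo_def hi_def by linarith
  have hi_arg: "c - 2 / of_int p + of_int 5 / of_int p = c' + 2 / of_int p"
    unfolding c'_def using p0 by (simp add: field_simps)
  have two_p: "0 \<le> 2 / real_of_int p" using p0 by simp
  have U_in: "lo i \<le> orb \<psi> a t i \<and> orb \<psi> a t i \<le> hi i" if "c \<le> t" "t \<le> c'" for t i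
    unfolding lo_def hi_def hi_arg using that two_p by (intro conjI orb_mono[OF \<psi>(1)]) linarith+
  have x_in: "lo i \<le> orb \<psi> b t i \<and> orb \<psi> b t i \<le> hi i"
    if "c \<le> t" "t \<le> c'" "- p < i" "i < 2 * p" for t i
  proof -
    have "\<bar>real_of_int i\<bar> \<le> 2 * of_int p" using that by linarith
    then have "\<bar>a - b\<bar> * \<bar>real_of_int i\<bar> \<le> 1 / (of_int p)\<^sup>2 * (2 * of_int p)"
      using ab by (intro mult_mono) auto
    also have "\<dots> = 2 / of_int p" using p0 by (simp add: power2_eq_square)
    finally have "\<bar>a * of_int i - b * of_int i\<bar> \<le> 2 / of_int p"
      by (simp flip: abs_mult add: left_diff_distrib)
    then show ?thesis
      unfolding lo_def hi_def hi_arg orb_def using that(1,2)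
      by (intro conjI hull_fun_mono[OF \<psi>(1)]) linarith+
  qed
  have Dle: "\<bar>u - v\<bar> \<le> D i" if "lo i \<le> u \<and> u \<le> hi i" "lo i \<le> v \<and> v \<le> hi i" for u v i
    using that unfolding D_def by linarith
  \<comment> \<open>Room for two successive perturbations of size at most 1: an orbit has increments
    up to \<open>\<bar>a\<bar> + 1\<close>, clipping adds 2, and exchanging blocks adds 2
    more.\<close>
  define K0 where "K0 = K - 2"
  have lipU: "orb \<psi> a t \<in> lip_seqs K0" and lipx: "orb \<psi> b t \<in> lip_seqs K0" for t
    using orb_lip_seqs[OF \<psi>(1), of a t] orb_lip_seqs[OF \<psi>(1), of b t] K
    unfolding lip_seqs_def K0_def by (auto intro: order_trans)
  have c'c1: "c' \<le> c + 1" unfolding c'_def using p0 by simp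
  have K0: "K0 + 2 \<le> K" "\<bar>a\<bar> + 1 + 2 \<le> K0" "\<bar>b\<bar> + 1 + 2 \<le> K0" unfolding K0_def using K by auto
  have swap: "\<exists>u' v'. u' \<in> per_seqs P Q \<and> v' \<in> per_seqs p q \<and> u' 0 = v 0 \<and> v' 0 = u 0 \<and>
      per_action S P u' + per_action S p v' \<le> per_action S P u + per_action S p v + err"
    if uv: "u \<in> per_seqs P Q" "u \<in> lip_seqs K0" "v \<in> per_seqs p q" "v \<in> lip_seqs K0"
      and near: "\<And>i. - p < i \<Longrightarrow> i < 2 * p \<Longrightarrow> \<bar>u i - v i\<bar> \<le> D i" for u v
    unfolding err_def r_def
    by (rule swap_blocks[OF p(2)[unfolded r_def] p0 P[unfolded r_def] uv K0(1) L near D_per D1 D_sum]) blast+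
  \<comment> \<open>Each inequality comes from one exchange between a constrained and a free (almost) minimiser of the
    two periods; all sequences involved stay between \<open>lo\<close> and \<open>hi\<close>, whose total gap over a period is 5.\<close>
  have "min_action_at P Q \<xi> + min_action p q \<le> min_action P Q + min_action_at p q \<xi> + 2 * \<eta> + err"
  proof -
    obtain y where y: "y \<in> per_seqs p q" "y 0 = \<xi>" "\<And>i. orb \<psi> a c i \<le> y i" "\<And>i. y i \<le> orb \<psi> a c' i"
      "per_action S p y \<le> min_action_at p q \<xi> + 2 * \<eta>"
      using squeeze[OF p0 U_per U_per orb_mono[OF \<psi>(1) cc'] orb_\<xi>
          U_act[of n, folded c_def] U_act[of "n + 1", folded c'_eq]] by blast
    have lipy: "y \<in> lip_seqs K0"
    proof (rule lip_seqs_near[OF orb_lip_seqs[OF \<psi>(1), of a c] K0(2)])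
      fix i show "\<bar>y i - orb \<psi> a c i\<bar> \<le> 1"
        using y(3)[of i] y(4)[of i] gap1[OF c'c1, of a i] by linarith
    qed
    have "\<bar>orb \<psi> b c i - y i\<bar> \<le> D i" if "- p < i" "i < 2 * p" for i
    proof (rule Dle)
      show "lo i \<le> orb \<psi> b c i \<and> orb \<psi> b c i \<le> hi i" by (rule x_in) (use cc' that in auto)
      show "lo i \<le> y i \<and> y i \<le> hi i"
        using U_in[of c i] U_in[of c' i] cc' y(3)[of i] y(4)[of i] by linarith
    qed
    with swap[OF x_per lipx y(1) lipy] obtain u' v' where
      uv: "u' \<in> per_seqs P Q" "v' \<in> per_seqs p q" "u' 0 = y 0"
      and le: "per_action S P u' + per_action S p v' \<le> per_action S P (orb \<psi> b c) + per_action S p y + err"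
      by metis
    have "min_action_at P Q \<xi> \<le> per_action S P u'" using uv y(2) by (intro min_action_at_le P0) auto
    moreover have "min_action p q \<le> per_action S p v'" using uv by (intro min_action_le p0)
    ultimately show ?thesis using le y(5) \<psi>(2)[of c] by linarith
  qed
  \<comment> \<open>In this direction the constrained sequence is clipped between exact minimisers
    at slope \<open>b\<close>, at no cost; only the free orbit at slope \<open>a\<close> contributes
    \<eta>.\<close>
  moreover have "min_action P Q + min_action_at p q \<xi> \<le> min_action_at P Q \<xi> + min_action p q + \<eta> + err"
  proof -
    obtain y where y: "y \<in> per_seqs P Q" "y 0 = \<xi>" "\<And>i. orb \<psi> b c i \<le> y i" "\<And>i. y i \<le> orb \<psi> b c' i"
      "per_action S P y \<le> min_action_at P Q \<xi> + 2 * 0"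
      using squeeze[OF P0 x_per x_per orb_mono[OF \<psi>(1) cc'] orb_\<xi>, of 0] \<psi>(2) by auto
    have lipy: "y \<in> lip_seqs K0"
    proof (rule lip_seqs_near[OF orb_lip_seqs[OF \<psi>(1), of b c] K0(3)])
      fix i show "\<bar>y i - orb \<psi> b c i\<bar> \<le> 1"
        using y(3)[of i] y(4)[of i] gap1[OF c'c1, of b i] by linarith
    qed
    have "\<bar>y i - orb \<psi> a c i\<bar> \<le> D i" if "- p < i" "i < 2 * p" for i
    proof (rule Dle)
      show "lo i \<le> orb \<psi> a c i \<and> orb \<psi> a c i \<le> hi i" by (rule U_in) (use cc' in auto)
      show "lo i \<le> y i \<and> y i \<le> hi i"
        using x_in[of c i] x_in[of c' i] cc' that y(3)[of i] y(4)[of i] by linarith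
    qed
    with swap[OF y(1) lipy U_per lipU] obtain u' v' where
      uv: "u' \<in> per_seqs P Q" "v' \<in> per_seqs p q" "v' 0 = y 0"
      and le: "per_action S P u' + per_action S p v' \<le> per_action S P y + per_action S p (orb \<psi> a c) + err"
      by metis
    have "min_action_at p q \<xi> \<le> per_action S p v'" using uv y(2) by (intro min_action_at_le p0) auto
    moreover have "min_action P Q \<le> per_action S P u'" using uv by (intro min_action_le P0)
    ultimately show ?thesis using le y(5) U_act[of n] unfolding c_def by linarith
  qed
  ultimately show ?thesis using \<eta>_le \<eta>0 by linarith
qed

end

section \<open>Irrational rotation numbers and continuity\<close>


lemma lip_seqs_mono: "x \<in> lip_seqs K \<Longrightarrow> K \<le> K' \<Longrightarrow> x \<in> lip_seqs K'"
  unfolding lip_seqs_def by (auto intro: order_trans)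

text \<open>Each of the two minima moves by at most \<open>p * \<delta>\<close>, provided a
  minimiser lies where the potentials are compared. Hull orbits have increments up to
  \<open>\<bar>a\<bar> + 1\<close>, and squeezing a constrained minimiser within distance 1 of one
  adds 2.\<close>

lemma peierls_rat_diff:
  fixes S S' :: "real ^ 'n::{finite,linorder} \<Rightarrow> real"
  assumes S: "potential S" and S': "potential S'" and K: "\<bar>of_rat a\<bar> + 3 \<le> K"
    and \<delta>: "\<And>x j. x \<in> lip_seqs K \<Longrightarrow> \<bar>S' (window x j) - S (window x j)\<bar> \<le> \<delta>"
  shows "\<bar>peierls_rat S' a \<xi> - peierls_rat S a \<xi>\<bar> \<le> 2 * of_int (snd (quotient_of a)) * \<delta>"
proof -
  obtain q p where qp: "quotient_of a = (q, p)" by fastforce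
  have p: "p > 0" using quotient_of_denom_pos[OF qp] .
  have a: "real_of_rat a = of_int q / of_int p"
    by (simp add: quotient_of_div[OF qp] of_rat_divide)
  have one: "potential.min_action T' p q \<le> potential.min_action T p q + of_int p * \<delta> \<and>
      potential.min_action_at T' p q \<xi> \<le> potential.min_action_at T p q \<xi> + of_int p * \<delta>"
    if T: "potential T" "potential T'"
      and d: "\<And>x j. x \<in> lip_seqs K \<Longrightarrow> \<bar>T' (window x j) - T (window x j)\<bar> \<le> \<delta>"
    for T T' :: "(real, 'n) vec \<Rightarrow> real"
  proof -
    interpret T: potential T by fact
    interpret T': potential T' by fact
    have act: "per_action T' p x \<le> per_action T p x + of_int p * \<delta>" if "x \<in> lip_seqs K" for x
    proof -
      have "per_action T' p x \<le> (\<Sum>j\<in>{0..<p}. T (window x j) + \<delta>)"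
        unfolding per_action_def using d[OF that] by (intro sum_mono) (simp add: abs_le_iff algebra_simps)
      then show ?thesis using p by (simp add: per_action_def sum.distrib)
    qed
    obtain \<phi> where \<phi>: "hull_fun \<phi>" "\<And>t. per_action T p (orb \<phi> (of_rat a) t) = T.min_action p q"
      using T.minimising_hull[OF p, of q] unfolding a by metis
    have per: "orb \<phi> (of_rat a) t \<in> per_seqs p q" for t
      unfolding a by (rule orb_per_seqs[OF \<phi>(1) p])
    have "orb \<phi> (of_rat a) 0 \<in> lip_seqs K"
      using orb_lip_seqs[OF \<phi>(1)] by (rule lip_seqs_mono) (use K in simp)
    from act[OF this] have "T'.min_action p q \<le> T.min_action p q + of_int p * \<delta>"
      using T'.min_action_le[OF p per, of 0] \<phi>(2)[of 0] by linarith
    moreover have "T'.min_action_at p q \<xi> \<le> T.min_action_at p q \<xi> + of_int p * \<delta>"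
    proof -
      \<comment> \<open>Integer phases suffice here: the orbit at \<open>m\<close> and its translate
        by 1 bracket \<xi>.\<close>
      define m where "m = \<lfloor>\<xi> - \<phi> 0\<rfloor>"
      have step: "orb \<phi> (of_rat a) (of_int m + 1) i = orb \<phi> (of_rat a) (of_int m) i + 1" for i
        using orb_add_int[OF \<phi>(1), of "of_rat a" "of_int m" 1 i] by simp
      have "orb \<phi> (of_rat a) (of_int m) 0 = \<phi> 0 + of_int m"
        using hull_fun_int[OF \<phi>(1), of 0 m] by (simp add: orb_def)
      then have "orb \<phi> (of_rat a) (of_int m) 0 \<le> \<xi>" "\<xi> \<le> orb \<phi> (of_rat a) (of_int m + 1) 0"
        using step[of 0] unfolding m_def by linarith+
      then obtain y where y: "y \<in> per_seqs p q" "y 0 = \<xi>" "\<And>i. orb \<phi> (of_rat a) (of_int m) i \<le> y i"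
        "\<And>i. y i \<le> orb \<phi> (of_rat a) (of_int m + 1) i" "per_action T p y \<le> T.min_action_at p q \<xi>"
        using T.squeeze[OF p per per orb_mono[OF \<phi>(1)], of "of_int m" "of_int m + 1" \<xi> 0] \<phi>(2)
        by (metis add_0_right less_eq_real_def less_add_one mult_zero_right)
      have "y \<in> lip_seqs K"
      proof (rule lip_seqs_near[OF orb_lip_seqs[OF \<phi>(1), of "of_rat a" "of_int m"]])
        show "\<bar>y i - orb \<phi> (of_rat a) (of_int m) i\<bar> \<le> 1" for i
          using y(3)[of i] y(4)[of i] step[of i] by linarith
      qed (use K in simp)
      from act[OF this] show ?thesis using T'.min_action_at_le[OF p y(1,2)] y(5) by linarith
    qed
    ultimately show ?thesis by blast
  qed
  have "\<bar>S (window x j) - S' (window x j)\<bar> \<le> \<delta>" if "x \<in> lip_seqs K" for x j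
    using \<delta>[OF that, of j] by (simp add: abs_minus_commute)
  from one[OF S' S this] one[OF S S' \<delta>] show ?thesis
    unfolding potential.peierls_rat_eq[OF S qp] potential.peierls_rat_eq[OF S' qp] by (simp add: qp abs_le_iff)
qed

text \<open>Near \<omega> only finitely many fractions have denominator at most \<open>N\<close>,
  and none of them equals \<omega>.\<close>

lemma irrational_denominators:
  fixes \<omega> :: real
  assumes "\<omega> \<notin> \<rat>"
  obtains d where "d > 0" "\<And>b. \<bar>of_rat b - \<omega>\<bar> < d \<Longrightarrow> N \<le> snd (quotient_of b)"
proof -
  define M where "M = \<bar>N\<bar> * (\<lceil>\<bar>\<omega>\<bar>\<rceil> + 1)"
  define F where "F = (\<lambda>(Q, P). real_of_int Q / of_int P) ` ({- M..M} \<times> {0..N})"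
  have "finite F" unfolding F_def by simp
  then obtain d where d: "d > 0" "\<And>x. x \<in> F \<Longrightarrow> x \<noteq> \<omega> \<Longrightarrow> d \<le> dist \<omega> x"
    using finite_set_avoid by metis
  have "N \<le> snd (quotient_of b)" if b: "\<bar>of_rat b - \<omega>\<bar> < min d 1" for b
  proof (rule ccontr)
    assume N: "\<not> ?thesis"
    obtain Q P where QP: "quotient_of b = (Q, P)" by fastforce
    have P: "P > 0" "P \<le> N" using quotient_of_denom_pos[OF QP] N QP by auto
    have b_eq: "real_of_rat b = of_int Q / of_int P"
      by (simp add: quotient_of_div[OF QP] of_rat_divide)
    have "\<bar>real_of_int Q / of_int P\<bar> \<le> of_int (\<lceil>\<bar>\<omega>\<bar>\<rceil> + 1)"
      using b unfolding b_eq by (simp add: abs_if split: if_splits) linarith+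
    then have "\<bar>real_of_int Q\<bar> \<le> of_int P * of_int (\<lceil>\<bar>\<omega>\<bar>\<rceil> + 1)"
      using P by (simp add: abs_divide divide_le_eq mult.commute)
    then have "\<bar>Q\<bar> \<le> P * (\<lceil>\<bar>\<omega>\<bar>\<rceil> + 1)" by (simp only: flip: of_int_mult of_int_abs)
    also have "\<dots> \<le> M" unfolding M_def using P by (intro mult_right_mono) auto
    finally have "of_rat b \<in> F" unfolding F_def b_eq using P by (auto intro!: image_eqI[of _ _ "(Q, P)"])
    moreover have "of_rat b \<noteq> \<omega>" using assms by auto
    ultimately show False using d(2) b by (force simp: dist_real_def abs_minus_commute)
  qed
  then show ?thesis using that[of "min d 1"] d(1) by simp
qed

text \<open>Dirichlet approximation: an irrational has infinitely many such fractions, hence some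
  with arbitrarily large denominator.\<close>

lemma irrational_good_approximation:
  fixes \<omega> :: real
  assumes "\<omega> \<notin> \<rat>"
  obtains q p :: int where "coprime q p" "N < p" "p > 0" "\<bar>\<omega> - of_int q / of_int p\<bar> < 1 / (of_int p)\<^sup>2"
proof -
  have "infinite (approx_set \<omega>)" using assms rational_iff_finite_approx_set by blast
  then obtain q p where "(q, p) \<in> approx_set \<omega>" "p > N" using infinite_approx_set by blast
  then show ?thesis using that[of q p] by (auto simp: approx_set_def)
qed

section \<open>Uniform approximation by rational barriers\<close>

lemma peierls_rat_cauchy:
  fixes \<omega> L e :: real
  assumes \<omega>: "\<omega> \<notin> \<rat>" and L: "L \<ge> 0" and e: "e > 0"
  obtains a d where "d > 0" "\<bar>of_rat a - \<omega>\<bar> \<le> 1"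
    "\<And>(S :: real ^ 'n::{finite,linorder} \<Rightarrow> real) b \<xi>. potential S \<Longrightarrow> lip_const (\<bar>\<omega>\<bar> + 6) L S \<Longrightarrow>
       \<bar>of_rat b - \<omega>\<bar> < d \<Longrightarrow> \<bar>peierls_rat S b \<xi> - peierls_rat S a \<xi>\<bar> \<le> e"
proof -
  let ?r = "CARD('n)"
  \<comment> \<open>The three entries provide the size conditions of
    \<open>barrier_comparison\<close> and push its error below \<open>e\<close>.\<close>
  define N where "N = max 5 (max (int ?r) \<lceil>24 * L * (real ?r)\<^sup>2 / e\<rceil>)"
  obtain q p where cop: "coprime q p" and N: "N < p" and p: "p > 0"
    and close: "\<bar>\<omega> - of_int q / of_int p\<bar> < 1 / (of_int p)\<^sup>2"
    using irrational_good_approximation[OF \<omega>, of N] by metis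
  define a where "a = Fract q p"
  have qp: "quotient_of a = (q, p)" unfolding a_def quotient_of_Fract using p cop by simp
  have a: "real_of_rat a = of_int q / of_int p"
    by (simp add: quotient_of_div[OF qp] of_rat_divide)
  have p1: "1 / (real_of_int p)\<^sup>2 \<le> 1" using p by simp
  have pe: "24 * L * (real ?r)\<^sup>2 / of_int p \<le> e"
  proof -
    have "24 * L * (real ?r)\<^sup>2 / e \<le> of_int p" using N unfolding N_def by linarith
    then show ?thesis using e p by (simp add: field_simps)
  qed
  obtain d1 where d1: "d1 > 0" "\<And>b. \<bar>of_rat b - \<omega>\<bar> < d1 \<Longrightarrow> p + int ?r \<le> snd (quotient_of b)"
    using irrational_denominators[OF \<omega>] by metis
  \<comment> \<open>Closeness within \<open>d\<close> forces a denominator of at least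
    \<open>p + CARD('n)\<close>, keeps the slope within 1 of \<omega>, and keeps it within the
    inverse square of \<open>p\<close> from \<open>a\<close>. None of this refers to the
    potential.\<close>
  define d where "d = min (min d1 1) (1 / (of_int p)\<^sup>2 - \<bar>\<omega> - of_int q / of_int p\<bar>)"
  have "\<bar>peierls_rat S b \<xi> - peierls_rat S a \<xi>\<bar> \<le> e"
    if S: "potential S" and lip: "lip_const (\<bar>\<omega>\<bar> + 6) L S" and b: "\<bar>of_rat b - \<omega>\<bar> < d"
    for S :: "(real, 'n) vec \<Rightarrow> real" and b \<xi>
  proof -
    interpret potential S by fact
    obtain Q P where QP: "quotient_of b = (Q, P)" by fastforce
    have b_eq: "real_of_rat b = of_int Q / of_int P"
      by (simp add: quotient_of_div[OF QP] of_rat_divide)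
    have P: "p + int ?r \<le> P" using d1(2)[of b] b QP unfolding d_def by simp
    have "\<bar>(min_action_at p q \<xi> - min_action p q) - (min_action_at P Q \<xi> - min_action P Q)\<bar>
        \<le> 24 * L * (real ?r)\<^sup>2 / of_int p"
    proof (rule barrier_comparison[OF cop _ _ P _ _ _ lip L])
      show "5 \<le> p" "int ?r \<le> p" using N unfolding N_def by auto
      have "\<bar>of_rat b - \<omega>\<bar> < 1 / (of_int p)\<^sup>2 - \<bar>\<omega> - of_int q / of_int p\<bar>" "\<bar>of_rat b - \<omega>\<bar> < 1"
        using b unfolding d_def by auto
      then show "\<bar>real_of_int q / of_int p - of_int Q / of_int P\<bar> \<le> 1 / (of_int p)\<^sup>2"
        "\<bar>real_of_int Q / of_int P\<bar> + 5 \<le> \<bar>\<omega>\<bar> + 6"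
        unfolding b_eq by linarith+
      show "\<bar>real_of_int q / of_int p\<bar> + 5 \<le> \<bar>\<omega>\<bar> + 6" using close p1 by linarith
    qed
    then show ?thesis unfolding peierls_rat_eq[OF qp] peierls_rat_eq[OF QP]
      using pe by (simp add: abs_minus_commute)
  qed
  moreover have "d > 0" unfolding d_def using d1(1) close by simp
  moreover have "\<bar>of_rat a - \<omega>\<bar> \<le> 1" unfolding a using close p1 by linarith
  ultimately show ?thesis using that by blast
qed

text \<open>Density of the rationals makes the filter proper, so that \<open>Lim\<close> in
  \<open>peierls\<close> is determined by convergence.\<close>

lemma rat_filter_neq_bot: "filtercomap real_of_rat (nhds \<omega>) \<noteq> bot"
proof (rule filtercomap_neq_bot)
  fix P assume "eventually P (nhds \<omega>)"
  then obtain d where d: "d > 0" "\<And>x. dist x \<omega> < d \<Longrightarrow> P x" unfolding eventually_nhds_metric by blast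
  obtain b where "\<omega> < of_rat b" "of_rat b < \<omega> + d" using of_rat_dense[of \<omega> "\<omega> + d"] d(1) by auto
  then show "\<exists>x. P (of_rat x)" using d(2)[of "of_rat b"] by (auto simp: dist_real_def)
qed

lemma eventually_rat_filter:
  "d > 0 \<Longrightarrow> eventually (\<lambda>b. \<bar>of_rat b - \<omega>\<bar> < d) (filtercomap real_of_rat (nhds \<omega>))"
  unfolding eventually_filtercomap
  by (rule exI[of _ "\<lambda>x. \<bar>x - \<omega>\<bar> < d"]) (auto simp: eventually_nhds_metric dist_real_def)

text \<open>All rational barriers close to \<omega> are within \<open>e / 3\<close> of a single one,
  so they form a Cauchy filter; completeness turns \<open>Lim\<close> into a genuine limit.\<close>

lemma tendsto_peierls:
  fixes S :: "real ^ 'n::{finite,linorder} \<Rightarrow> real"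
  assumes \<omega>: "\<omega> \<notin> \<rat>" and L: "L \<ge> 0" and S: "potential S" "lip_const (\<bar>\<omega>\<bar> + 6) L S"
  shows "((\<lambda>b. peierls_rat S b \<xi>) \<longlongrightarrow> peierls S \<omega> \<xi>) (filtercomap real_of_rat (nhds \<omega>))"
proof -
  let ?F = "filtercomap real_of_rat (nhds \<omega>)" and ?g = "\<lambda>b. peierls_rat S b \<xi>"
  have "cauchy_filter (filtermap ?g ?F)"
    unfolding cauchy_filter_metric_filtermap
  proof (intro allI impI)
    fix e :: real assume "e > 0"
    then obtain a d where d: "d > 0" "\<And>b. \<bar>of_rat b - \<omega>\<bar> < d \<Longrightarrow> \<bar>?g b - ?g a\<bar> \<le> e / 3"
      using peierls_rat_cauchy[OF \<omega> L, of "e / 3"] S by (metis divide_pos_pos zero_less_numeral)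
    show "\<exists>P. eventually P ?F \<and> (\<forall>x y. P x \<and> P y \<longrightarrow> dist (?g x) (?g y) < e)"
    proof (intro exI conjI allI impI)
      show "eventually (\<lambda>b. \<bar>of_rat b - \<omega>\<bar> < d) ?F" by (rule eventually_rat_filter[OF d(1)])
      fix x y assume "\<bar>of_rat x - \<omega>\<bar> < d \<and> \<bar>of_rat y - \<omega>\<bar> < d"
      then show "dist (?g x) (?g y) < e"
        using d(2)[of x] d(2)[of y] \<open>e > 0\<close> unfolding dist_real_def by linarith
    qed
  qed
  then obtain l where "filtermap ?g ?F \<le> nhds l"
    using cauchy_filter_complete_converges[OF _ complete_UNIV, of "filtermap ?g ?F"] rat_filter_neq_bot
    by (auto simp: filtermap_bot_iff)
  then have lim: "(?g \<longlongrightarrow> l) ?F" by (simp add: filterlim_def)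
  moreover have "peierls S \<omega> \<xi> = l"
    unfolding peierls_def using \<omega> tendsto_Lim[OF rat_filter_neq_bot lim] by simp
  ultimately show ?thesis by simp
qed

text \<open>A single rational \<open>a\<close> serves every potential with the given Lipschitz
  constant, which reduces the perturbation problem to one fixed period. For rational \<omega> it is
  \<omega> itself.\<close>

lemma peierls_approx:
  fixes \<omega> L e :: real
  assumes L: "L \<ge> 0" and e: "e > 0"
  obtains a where "\<bar>of_rat a - \<omega>\<bar> \<le> 1"
    "\<And>(S :: real ^ 'n::{finite,linorder} \<Rightarrow> real) \<xi>. potential S \<Longrightarrow> lip_const (\<bar>\<omega>\<bar> + 6) L S \<Longrightarrow>
       \<bar>peierls S \<omega> \<xi> - peierls_rat S a \<xi>\<bar> \<le> e"
proof (cases "\<omega> \<in> \<rat>")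
  case True
  then obtain a where a: "\<omega> = of_rat a" by (auto elim: Rats_cases)
  then have "(THE a. real_of_rat a = \<omega>) = a" by (intro the_equality) auto
  then show ?thesis using that[of a] a True e unfolding peierls_def by simp
next
  case False
  obtain a d where d: "d > 0" "\<bar>of_rat a - \<omega>\<bar> \<le> 1" and
    *: "\<And>(S :: (real, 'n) vec \<Rightarrow> real) b \<xi>. potential S \<Longrightarrow> lip_const (\<bar>\<omega>\<bar> + 6) L S \<Longrightarrow>
       \<bar>of_rat b - \<omega>\<bar> < d \<Longrightarrow> \<bar>peierls_rat S b \<xi> - peierls_rat S a \<xi>\<bar> \<le> e"
    using peierls_rat_cauchy[OF False L e, where 'n = 'n] by metis
  have "\<bar>peierls S \<omega> \<xi> - peierls_rat S a \<xi>\<bar> \<le> e"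
    if "potential S" "lip_const (\<bar>\<omega>\<bar> + 6) L S" for S :: "(real, 'n) vec \<Rightarrow> real" and \<xi>
  proof (rule tendsto_upperbound[OF _ _ rat_filter_neq_bot])
    show "((\<lambda>b. \<bar>peierls_rat S b \<xi> - peierls_rat S a \<xi>\<bar>) \<longlongrightarrow> \<bar>peierls S \<omega> \<xi> - peierls_rat S a \<xi>\<bar>)
        (filtercomap real_of_rat (nhds \<omega>))"
      by (intro tendsto_intros tendsto_peierls[OF False L that])
    show "\<forall>\<^sub>F b in filtercomap real_of_rat (nhds \<omega>). \<bar>peierls_rat S b \<xi> - peierls_rat S a \<xi>\<bar> \<le> e"
      using eventually_rat_filter[OF d(1)] by eventually_elim (rule *[OF that])
  qed
  then show ?thesis using that d(2) by blast
qed

section \<open>Perturbed potentials and the final estimate\<close>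

lemma potentialI:
  assumes "condA S" "condB S" "condC S"
  shows "potential S"
proof (rule potential.intro)
  show "submodular S" by (rule condB_submodular[OF assms(2)])
  show "continuous_on UNIV S"
    using assms(2) is_C1_continuous[of S] by (simp add: condB_def is_C2_def)
qed (fact assms)+

lemma C0_norm_bound:
  fixes f :: "real ^ 'n::{finite,linorder} \<Rightarrow> real"
  assumes "C0_norm K f \<le> ereal c" "x \<in> lip_seqs K"
  shows "\<bar>f (window x j)\<bar> \<le> c"
proof -
  have "ereal \<bar>f (window (\<lambda>i. x (i + j)) 0)\<bar> \<le> C0_norm K f"
    unfolding C0_norm_def by (rule SUP_upper) (rule lip_seqs_shift[OF assms(2)])
  then show ?thesis using assms(1) window_shift[of x j] by (metis ereal_less_eq(3) order_trans)
qed

lemma partial_diff: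
  assumes "f differentiable (at x)" "g differentiable (at x)"
  shows "partial k (\<lambda>x. f x - g x) x = partial k f x - partial k g x"
proof -
  let ?D = "\<lambda>f. \<lambda>h. \<Sum>k\<in>UNIV. h $ k * partial k f x"
  have "((\<lambda>x. f x - g x) has_derivative (\<lambda>h. ?D f h - ?D g h)) (at x)"
    by (intro has_derivative_diff has_derivative_partial assms)
  moreover have "((\<lambda>x. f x - g x) has_derivative ?D (\<lambda>x. f x - g x)) (at x)"
    by (intro has_derivative_partial differentiable_diff assms)
  ultimately have "(\<lambda>h. ?D f h - ?D g h) = ?D (\<lambda>x. f x - g x)"
    by (rule has_derivative_unique)
  from fun_cong[OF this, of "axis k 1"] show ?thesis
    by (simp add: axis_def if_distrib[of "\<lambda>c. c * _"] cong: if_cong)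
qed

text \<open>The C1 estimate provides one Lipschitz constant for all admissible perturbations, so
  that \<open>peierls_approx\<close> applies to them with the same rational.\<close>

lemma lip_const_perturbation:
  fixes S S' :: "real ^ 'n::{finite,linorder} \<Rightarrow> real"
  assumes S: "is_C1 S" and S': "is_C1 S'"
    and L: "\<And>k x. x \<in> lip_seqs K \<Longrightarrow> \<bar>partial k S (window x 0)\<bar> \<le> L"
    and C1: "C1_norm K (\<lambda>x. S' x - S x) \<le> 1"
  shows "lip_const K (L + 1) S'"
proof (rule lip_constI)
  show "S' differentiable (at x)" for x using S' unfolding is_C1_def by blast
  fix k x assume x: "x \<in> lip_seqs K"
  have "C0_norm K (partial k (\<lambda>x. S' x - S x)) \<le> C1_norm K (\<lambda>x. S' x - S x)"
    unfolding C1_norm_def by (intro max.coboundedI2 Max_ge) auto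
  also have "\<dots> \<le> ereal 1" using C1 by (simp add: one_ereal_def)
  finally have "\<bar>partial k (\<lambda>x. S' x - S x) (window x 0)\<bar> \<le> 1" using x by (rule C0_norm_bound)
  moreover have "partial k (\<lambda>x. S' x - S x) y = partial k S' y - partial k S y" for y
    using S S' unfolding is_C1_def by (intro partial_diff) auto
  ultimately show "\<bar>partial k S' (window x 0)\<bar> \<le> L + 1" using L[OF x, of k] by simp
qed

theorem proposition6p1:
  fixes r :: nat and \<omega> :: real and S :: "real ^ 'n::{finite,linorder} \<Rightarrow> real" and \<epsilon> :: real
  assumes "r \<ge> 1" and "CARD('n::{finite,linorder}) = r + 1"
    and "condA S" and "condB S" and "condC S"
    and "\<epsilon> > 0"
  shows "\<exists>\<delta>>0. \<exists>K>0. \<forall>S\<delta> :: real ^ 'n::{finite,linorder} \<Rightarrow> real.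
           condA S\<delta> \<and> condB S\<delta> \<and> condC S\<delta> \<and>
           C0_norm K (\<lambda>x. S\<delta> x - S x) < ereal \<delta> \<and>
           C1_norm K (\<lambda>x. S\<delta> x - S x) \<le> 1 \<longrightarrow>
           (SUP \<xi>. ereal \<bar>peierls S\<delta> \<omega> \<xi> - peierls S \<omega> \<xi>\<bar>) < ereal \<epsilon>"
proof -
  define K where "K = \<bar>\<omega>\<bar> + 6"
  have C1: "is_C1 S" using \<open>condB S\<close> unfolding condB_def is_C2_def by blast
  obtain L where L: "L \<ge> 0" and pb: "\<And>k x. x \<in> lip_seqs K \<Longrightarrow> \<bar>partial k S (window x 0)\<bar> \<le> L"
    using partial_bounded[OF \<open>condA S\<close> C1] by metis
  have S: "potential S" by (rule potentialI) fact+
  have lipS: "lip_const K (L + 1) S"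
  proof (rule lip_constI)
    show "S differentiable (at x)" for x using C1 unfolding is_C1_def by blast
    show "\<bar>partial k S (window x 0)\<bar> \<le> L + 1" if "x \<in> lip_seqs K" for k x
      using pb[OF that, of k] by simp
  qed
  obtain a where a: "\<bar>of_rat a - \<omega>\<bar> \<le> 1" and
    approx: "\<And>(S :: (real, 'n) vec \<Rightarrow> real) \<xi>. potential S \<Longrightarrow> lip_const K (L + 1) S \<Longrightarrow>
       \<bar>peierls S \<omega> \<xi> - peierls_rat S a \<xi>\<bar> \<le> \<epsilon> / 6"
    using peierls_approx[of "L + 1" "\<epsilon> / 6" \<omega>, where 'n = 'n] L \<open>\<epsilon> > 0\<close> unfolding K_def by auto
  define p where "p = snd (quotient_of a)"
  have p: "p > 0" unfolding p_def by (rule quotient_of_denom_pos')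
  \<comment> \<open>Chosen so that the change \<open>2 * p * \<delta>\<close> of the barrier at
    \<open>a\<close> is \<open>\<epsilon> / 6\<close>, like each of the two approximation
    errors.\<close>
  define \<delta> where "\<delta> = \<epsilon> / (12 * of_int p)"
  have "(SUP \<xi>. ereal \<bar>peierls S' \<omega> \<xi> - peierls S \<omega> \<xi>\<bar>) < ereal \<epsilon>"
    if S': "condA S'" "condB S'" "condC S'" and C0: "C0_norm K (\<lambda>x. S' x - S x) < ereal \<delta>"
      and C1': "C1_norm K (\<lambda>x. S' x - S x) \<le> 1" for S' :: "(real, 'n) vec \<Rightarrow> real"
  proof -
    have pot: "potential S'" by (rule potentialI) fact+
    have lipS': "lip_const K (L + 1) S'"
      by (rule lip_const_perturbation[OF C1 _ pb C1']) (use S'(2) in \<open>simp_all add: condB_def is_C2_def\<close>)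
    have "\<bar>peierls S' \<omega> \<xi> - peierls S \<omega> \<xi>\<bar> \<le> \<epsilon> / 2" for \<xi>
    proof -
      have "\<bar>peierls_rat S' a \<xi> - peierls_rat S a \<xi>\<bar> \<le> 2 * of_int (snd (quotient_of a)) * \<delta>"
      proof (rule peierls_rat_diff[OF S pot])
        show "\<bar>of_rat a\<bar> + 3 \<le> K" using a unfolding K_def by linarith
        show "\<bar>S' (window x j) - S (window x j)\<bar> \<le> \<delta>" if "x \<in> lip_seqs K" for x j
          by (rule C0_norm_bound[OF less_imp_le[OF C0] that])
      qed
      also have "\<dots> = \<epsilon> / 6" using p unfolding \<delta>_def p_def by simp
      finally show ?thesis using approx[OF S lipS, of \<xi>] approx[OF pot lipS', of \<xi>] by linarith
    qed
    \<comment> \<open>A supremum need not preserve strict inequality, hence the pointwise bound by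
      half of \<epsilon>.\<close>
    then have "(SUP \<xi>. ereal \<bar>peierls S' \<omega> \<xi> - peierls S \<omega> \<xi>\<bar>) \<le> ereal (\<epsilon> / 2)"
      by (intro SUP_least) simp
    also have "\<dots> < ereal \<epsilon>" using \<open>\<epsilon> > 0\<close> by simp
    finally show ?thesis .
  qed
  moreover have "\<delta> > 0" "K > 0" using \<open>\<epsilon> > 0\<close> p unfolding \<delta>_def K_def by auto
  ultimately show ?thesis by blast
qed

end
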